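(* Let $(\mathfrak X,d)$ be a separable and complete CC space. (i) Let $\{\mathcal F_n,n\ge1\}$ be an increasing sequence of sub-$\sigma$-algebras of $\mathcal F$ and let $\mathcal F_\infty=\sigma(\bigcup_{n\ge1}\mathcal F_n)$. If $X\in L^p_{\mathfrak X}$ for some $p\ge1$, then $E(X|\mathcal F_n)\to E(X|\mathcal F_\infty)$ a.s. and in $L^p_{\mathfrak X}$ as $n\to\infty$. (ii) Let $\{\mathcal F_{-n},n\ge1\}$ be a decreasing sequence of sub-$\sigma$-algebras of $\mathcal F$ and let $\mathcal F_{-\infty}=\bigcap_{n\ge1}\mathcal F_{-n}$. If $X\in L^p_{\mathfrak X}$ for some $p\ge1$, then $E(X|\mathcal F_{-n})\to E(X|\mathcal F_{-\infty})$ a.s. and in $L^p_{\mathfrak X}$ as $n\to\infty$.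
   Context: A convex combination space (CC space) is a metric space $(\mathfrak X,d)$ endowed with a convex combination operation, which to all $n\ge1$, all $\lambda_1,\dots,\lambda_n>0$ with $\sum_{i=1}^n\lambda_i=1$ and all $u_1,\dots,u_n\in\mathfrak X$ assigns an element $[\lambda_1,u_1;\dots;\lambda_n,u_n]=[\lambda_i,u_i]_{i=1}^n$ of $\mathfrak X$, with $[1,u]=u$, and such that: (CC.i) $[\lambda_i,u_i]_{i=1}^n=[\lambda_{\sigma(i)},u_{\sigma(i)}]_{i=1}^n$ for every permutation $\sigma$ of $\{1,\dots,n\}$; (CC.ii) $[\lambda_i,u_i]_{i=1}^{n+2}=\big[\lambda_1,u_1;\dots;\lambda_n,u_n;\lambda_{n+1}+\lambda_{n+2},\big[\tfrac{\lambda_{n+j}}{\lambda_{n+1}+\lambda_{n+2}},u_{n+j}\big]_{j=1}^2\big]$; (CC.iii) if $u,v\in\mathfrak X$ and $\lambda^{(k)}\to\lambda\in(0,1)$ then $[\lambda^{(k)},u;1-\lambda^{(k)},v]\to[\lambda,u;1-\lambda,v]$; (CC.iv) for $u_1,u_2,v_1,v_2\in\mathfrak X$ and $\lambda\in(0,1)$, $d([\lambda,u_1;1-\lambda,u_2],[\lambda,v_1;1-\lambda,v_2])\le\lambda d(u_1,v_1)+(1-\lambda)d(u_2,v_2)$; (CC.v) for each $u\in\mathfrak X$ the limit $Ku:=\lim_{n\to\infty}[n^{-1},u]_{i=1}^n$ exists in $\mathfrak X$; $K$ is called the convexification operator. Write $K(\mathfrak X)=\{Ku:u\in\mathfrak X\}$;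 $K$ is idempotent. For points of $K(\mathfrak X)$, weights in $[0,1]$ are allowed by discarding entries with weight $0$. $(\Omega,\mathcal F,P)$ is a complete probability space without atoms. A random element is a map $X:\Omega\to\mathfrak X$ measurable with respect to $\mathcal F$ and the Borel $\sigma$-algebra. $L^p_{\mathfrak X}$ is the space of (a.s. equivalence classes of) random elements $X$ such that $d^p(u,X)$ is integrable for some (equivalently every) $u\in\mathfrak X$, with metric $\Delta_p(X,Y)=(E\,d^p(X,Y))^{1/p}$ for $p\ge1$; integrable means in $L^1_{\mathfrak X}$. A simple random element takes finitely many values; if $X=x_i$ on $\Omega_i$, where $\Omega_1,\dots,\Omega_n$ is a measurable partition of $\Omega$, write $X=[I_{\Omega_i},x_i]_{i=1}^n$ and define, for a sub-$\sigma$-algebra $\mathcal G\subset\mathcal F$, $E(X|\mathcal G)=[E(I_{\Omega_i}|\mathcal G),Kx_i]_{i=1}^n$. For integrable $X$: fix $u_0\in K(\mathfrak X)$ and a countable dense set $\{u_j:j\ge1\}\subset\mathfrak X$, let $\psi_n(x)=u_{m_n(x)}$, where $m_n(x)$ is the smallest $i\in\{0,\dots,n\}$ with $d(u_i,x)=\min_{0\le j\le n}d(u_j,x)$, and define the conditional expectation $E(X|\mathcal G)=\lim_{n\to\infty}E(\psi_n(X)|\mathcal G)$ a.s. (up to a null set); the limit exists and is an integrable, $\mathcal G$-measurable, $K(\mathfrak X)$-valued random element. *)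

theory Defs
  imports "HOL-Probability.Probability" "HOL-Combinatorics.Combinatorics"
begin

section \<open>Convex combination spaces\<close>

text \<open>The combination \<open>[\<lambda>\<^sub>1,u\<^sub>1; \<dots>; \<lambda>\<^sub>n,u\<^sub>n]\<close> is \<open>cc [(\<lambda>\<^sub>1,u\<^sub>1), \<dots>, (\<lambda>\<^sub>n,u\<^sub>n)]\<close>. Nothing is required
  of \<open>cc\<close> on lists that do not satisfy the following predicate (which excludes the empty list).\<close>

definition cc_admissible :: "(real \<times> 'a) list \<Rightarrow> bool" where
  "cc_admissible ws \<longleftrightarrow> (\<forall>(l, u) \<in> set ws. l > 0) \<and> (\<Sum>(l, u) \<leftarrow> ws. l) = 1"

locale cc_space =
  fixes cc :: "(real \<times> 'a::metric_space) list \<Rightarrow> 'a"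
  assumes cc_singleton: "cc [(1, u)] = u"
    and cc_permute:
      "cc_admissible ws \<Longrightarrow> \<sigma> permutes {..<length ws} \<Longrightarrow> cc (permute_list \<sigma> ws) = cc ws"
    and cc_associative:
      "cc_admissible (ws @ [(a, u), (b, v)]) \<Longrightarrow>
        cc (ws @ [(a, u), (b, v)]) = cc (ws @ [(a + b, cc [(a / (a + b), u), (b / (a + b), v)])])"
    and cc_continuous:
      "(\<And>k. 0 < ts k \<and> ts k < 1) \<Longrightarrow> 0 < t \<Longrightarrow> t < 1 \<Longrightarrow> ts \<longlonglongrightarrow> t \<Longrightarrow>
        (\<lambda>k::nat. cc [(ts k, u), (1 - ts k, v)]) \<longlonglongrightarrow> cc [(t, u), (1 - t, v)]"
    and cc_dist:
      "0 < t \<Longrightarrow> t < 1 \<Longrightarrow>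
        dist (cc [(t, u1), (1 - t, u2)]) (cc [(t, v1), (1 - t, v2)])
          \<le> t * dist u1 v1 + (1 - t) * dist u2 v2"
    and cc_convexification: "convergent (\<lambda>n. cc (replicate n (1 / real n, u)))"

definition cc_K :: "((real \<times> 'a::metric_space) list \<Rightarrow> 'a) \<Rightarrow> 'a \<Rightarrow> 'a" where
  "cc_K cc u = lim (\<lambda>n. cc (replicate n (1 / real n, u)))"

text \<open>Combinations of points of the range of \<open>cc_K cc\<close>, with weights in \<open>[0,1]\<close>.\<close>

definition cc_comb0 :: "((real \<times> 'a::metric_space) list \<Rightarrow> 'a) \<Rightarrow> (real \<times> 'a) list \<Rightarrow> 'a" where
  "cc_comb0 cc ws = cc (filter (\<lambda>(l, u). l \<noteq> 0) ws)"


section \<open>Random elements\<close>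

definition atomless :: "'w measure \<Rightarrow> bool" where
  "atomless M \<longleftrightarrow>
    (\<forall>A \<in> sets M. emeasure M A > 0 \<longrightarrow>
      (\<exists>B \<in> sets M. B \<subseteq> A \<and> 0 < emeasure M B \<and> emeasure M B < emeasure M A))"

text \<open>Elements of \<open>L\<^sup>p\<close> are represented by functions; equality almost everywhere is not
  quotiented out.\<close>

definition Lp_elements :: "'w measure \<Rightarrow> real \<Rightarrow> ('w \<Rightarrow> 'a::metric_space) set" where
  "Lp_elements M p =
    {X \<in> borel_measurable M. \<exists>u. integrable M (\<lambda>\<omega>. dist u (X \<omega>) powr p)}"

definition Lp_dist :: "'w measure \<Rightarrow> real \<Rightarrow> ('w \<Rightarrow> 'a::metric_space) \<Rightarrow> ('w \<Rightarrow> 'a) \<Rightarrow> real" where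
  "Lp_dist M p X Y = (\<integral>\<omega>. dist (X \<omega>) (Y \<omega>) powr p \<partial>M) powr (1 / p)"

definition Lp_converges ::
    "'w measure \<Rightarrow> real \<Rightarrow> (nat \<Rightarrow> 'w \<Rightarrow> 'a::metric_space) \<Rightarrow> ('w \<Rightarrow> 'a) \<Rightarrow> bool" where
  "Lp_converges M p Xs X \<longleftrightarrow>
    (\<forall>n. Xs n \<in> Lp_elements M p) \<and> X \<in> Lp_elements M p \<and> (\<lambda>n. Lp_dist M p (Xs n) X) \<longlonglongrightarrow> 0"


section \<open>Conditional expectation\<close>

text \<open>Let \<open>X\<close> take the distinct values \<open>x\<^sub>1, \<dots>, x\<^sub>n\<close>. The conditional probabilities
  \<open>E(I{X = x\<^sub>i} | G)\<close> given by the library are nonnegative and sum to \<open>1\<close> only outside a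
  \<open>G\<close>-measurable null set; on that set the value is set to \<open>K x\<^sub>1\<close>, so that the result is everywhere
  defined, \<open>G\<close>-measurable and with values in the range of \<open>K\<close>. The order of the values is
  immaterial by the permutation axiom, up to that null set.\<close>

definition cc_simple_cond_exp ::
    "((real \<times> 'a::metric_space) list \<Rightarrow> 'a) \<Rightarrow> 'w measure \<Rightarrow> 'w measure \<Rightarrow> ('w \<Rightarrow> 'a) \<Rightarrow> 'w \<Rightarrow> 'a" where
  "cc_simple_cond_exp cc M G X \<omega> =
    (let xs = (SOME xs. distinct xs \<and> set xs = X ` space M);
         pr = (\<lambda>x. real_cond_exp M G (indicator {\<omega>' \<in> space M. X \<omega>' = x}) \<omega>)
     in if (\<forall>x \<in> set xs. pr x \<ge> 0) \<and> (\<Sum>x \<leftarrow> xs. pr x) = 1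
        then cc_comb0 cc (map (\<lambda>x. (pr x, cc_K cc x)) xs)
        else cc_K cc (hd xs))"

definition nearest_index :: "(nat \<Rightarrow> 'a::metric_space) \<Rightarrow> nat \<Rightarrow> 'a \<Rightarrow> nat" where
  "nearest_index u n x = (LEAST i. i \<le> n \<and> dist (u i) x = Min ((\<lambda>j. dist (u j) x) ` {0..n}))"

definition nearest_point :: "(nat \<Rightarrow> 'a::metric_space) \<Rightarrow> nat \<Rightarrow> 'a \<Rightarrow> 'a" where
  "nearest_point u n x = u (nearest_index u n x)"

text \<open>The limit exists almost surely when \<open>X\<close> is integrable; elsewhere the value is \<open>u 0\<close>, which
  is a point of the range of \<open>K\<close>.\<close>

definition cc_cond_exp ::
    "((real \<times> 'a::metric_space) list \<Rightarrow> 'a) \<Rightarrow> (nat \<Rightarrow> 'a) \<Rightarrow> 'w measure \<Rightarrow> 'w measure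
      \<Rightarrow> ('w \<Rightarrow> 'a) \<Rightarrow> 'w \<Rightarrow> 'a" where
  "cc_cond_exp cc u M G X \<omega> =
    (let S = (\<lambda>n. cc_simple_cond_exp cc M G (nearest_point u n \<circ> X) \<omega>)
     in if convergent S then lim S else u 0)"

end

theory Submission
  imports Defs
begin

text \<open>A combination of points of the range of \<open>K\<close> depends only on the total weight that each point
  carries. Hence the distance of two such combinations is at most the transport cost of every
  coupling of their weights. Applied conditionally on \<open>G\<close>, this gives
  \<open>d(E(Y|G), E(Z|G)) \<le> E(d(Y,Z)|G)\<close> for simple \<open>Y\<close>, \<open>Z\<close>, and so
  \<open>d(E(\<psi>\<^sub>n X|G), E(X|G)) \<le> E(h\<^sub>n|G)\<close> with \<open>h\<^sub>n = d(\<psi>\<^sub>n X, X)\<close> decreasing to \<open>0\<close>. It also shows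
  that combinations depend continuously on their weights, so for fixed \<open>n\<close> the convergence of
  \<open>E(\<psi>\<^sub>n X|F\<^sub>k)\<close> follows from Levy's theorem for the indicators of the level sets of \<open>\<psi>\<^sub>n X\<close>.
  The remaining errors are small almost surely, uniformly in \<open>k\<close>, by Doob's maximal inequality
  for \<open>E(h\<^sub>n|F\<^sub>k)\<close>, and small in \<open>L\<^sup>p\<close> by Jensen's inequality. Both Levy theorems come from one
  argument: the squared \<open>L\<^sup>2\<close> norms of a bounded monotone family of conditional expectations are
  monotone and bounded, which makes the family Cauchy in \<open>L\<^sup>1\<close>, and the maximal inequality on finite
  windows upgrades this to almost sure convergence.\<close>

section \<open>Combinations in convex combination spaces\<close>

text \<open>In a general convex combination space a combination of copies of one point
  \<open>v\<close> need not be \<open>v\<close>, so repeated points cannot be merged and two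
  partitions describing the same simple random element may give different combinations. Points of
  the range of K do merge. This is what makes passing to a common refinement of two partitions
  legitimate, and couplings live on that refinement. The space has no linear structure, so
  martingale arguments cannot act on the random elements themselves. All probability is done for
  real functions: indicators of level sets, which govern the weights, and the errors h_n, which
  govern the distances. Each E(X|F_k) is its own limit in n, so convergence in k is an interchange
  of limits. An n that is good for one k is not enough; this is why Markov's inequality for each k
  is replaced by a maximal inequality over all k. A decreasing family can be read backwards as an
  increasing one only on a finite window. The maximal inequality is therefore proved for finite
  families, with a bound that does not depend on their length.\<close>

lemma tendsto_dist_squeeze:
  assumes "(g \<longlongrightarrow> (0::real)) F" "\<forall>\<^sub>F k in F. dist (f k) l \<le> g k"
  shows "(f \<longlongrightarrow> l) F"
proof (rule tendsto_dist_iff[THEN iffD2])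
  show "((\<lambda>k. dist (f k) l) \<longlongrightarrow> 0) F"
    using tendsto_sandwich[of "\<lambda>_. 0" "\<lambda>k. dist (f k) l" F g 0] assms by simp
qed

lemma sum_list_eq_sum_mset_prod:
  "(\<Sum>(l, u) \<leftarrow> ws. f l u) = (\<Sum>(l, u) \<in># mset ws. (f l u :: real))"
  by (metis mset_map sum_mset_sum_list)

lemma cc_admissible_mset:
  "mset ws = mset vs \<Longrightarrow> cc_admissible ws \<longleftrightarrow> cc_admissible vs"
  unfolding cc_admissible_def sum_list_eq_sum_mset_prod by (metis set_mset_mset)

lemma cc_admissible_append:
  "cc_admissible (ws @ vs) \<longleftrightarrow> (\<forall>(l, u) \<in> set ws \<union> set vs. l > 0) \<and>
     (\<Sum>(l, u) \<leftarrow> ws. l) + (\<Sum>(l, u) \<leftarrow> vs. l) = 1"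
  unfolding cc_admissible_def by (auto simp: ball_Un)

lemma sum_list_scale:
  "(\<Sum>(l, u) \<leftarrow> map (\<lambda>(l, u). (a * l, u)) ws. l) = a * (\<Sum>(l, u) \<leftarrow> ws. (l::real))"
  by (induction ws) (auto simp: algebra_simps)

lemma cc_admissible_scale:
  assumes "0 < t" "t < 1" "cc_admissible ws" "cc_admissible vs"
  shows "cc_admissible (map (\<lambda>(l, u). (t * l, u)) ws @ map (\<lambda>(l, u). ((1 - t) * l, u)) vs)"
proof -
  have "(\<Sum>(l, u) \<leftarrow> ws. l) = 1" "(\<Sum>(l, u) \<leftarrow> vs. l) = 1"
    using assms(3,4) by (auto simp: cc_admissible_def)
  then have "(\<Sum>(l, u) \<leftarrow> map (\<lambda>(l, u). (t * l, u)) ws. l) + (\<Sum>(l, u) \<leftarrow> map (\<lambda>(l, u). ((1 - t) * l, u)) vs. l) = 1"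
    by (simp only: sum_list_scale) simp
  then show ?thesis
    unfolding cc_admissible_append using assms by (auto simp: cc_admissible_def)
qed

lemma rev_cases2:
  obtains "ws = []" | x where "ws = [x]" | ws' x y where "ws = ws' @ [x, y]"
proof (cases ws rule: rev_cases)
  case (snoc vs y)
  then show ?thesis using that by (cases vs rule: rev_cases) auto
qed (use that in auto)

context cc_space
begin

lemma cc_mset:
  assumes "cc_admissible ws" "mset vs = mset ws"
  shows "cc vs = cc ws"
  by (metis assms cc_permute mset_eq_permutation)

text \<open>Nested combinations flatten. Associativity merges the last two entries of
  \<open>ws\<close>, once inside the inner combination and once in the outer list after scaling by
  \<open>a\<close>. The factor \<open>a\<close> cancels in the ratios of weights, so both mergers
  create the same new point, and the induction continues with a list shorter by one.\<close>

lemma cc_substitute: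
  assumes "cc_admissible ws" "a > 0" "cc_admissible (vs @ [(a, cc ws)])"
  shows "cc (vs @ map (\<lambda>(l, x). (a * l, x)) ws) = cc (vs @ [(a, cc ws)])"
  using assms
proof (induction "length ws" arbitrary: ws rule: less_induct)
  case less
  have sum1: "(\<Sum>(l, u) \<leftarrow> ws. l) = 1" and pos: "\<forall>(l, u) \<in> set ws. l > 0"
    using less.prems by (auto simp: cc_admissible_def)
  show ?case
  proof (cases ws rule: rev_cases2)
    case 1 then show ?thesis using sum1 by simp
  next
    case (2 x)
    then obtain p where "x = (1, p)" using sum1 by (cases x) auto
    then show ?thesis using 2 by (simp add: cc_singleton)
  next
    case (3 ws' x y)
    obtain b p c q where xy: "x = (b, p)" "y = (c, q)" by (cases x; cases y)
    have bc: "b > 0" "c > 0" using pos by (auto simp: 3 xy)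
    let ?z = "cc [(b / (b + c), p), (c / (b + c), q)]"
    let ?ws = "ws' @ [(b + c, ?z)]"
    have adm': "cc_admissible ?ws" using less.prems(1) bc
      by (auto simp: 3 xy cc_admissible_append)
    have e1: "cc ws = cc ?ws"
      using less.prems(1) cc_associative[of ws' b p c q] by (simp add: 3 xy)
    let ?sc = "\<lambda>(l, x). (a * l, x)"
    have "cc_admissible (vs @ map ?sc ws)"
    proof -
      have "(\<Sum>(l, u) \<leftarrow> map ?sc ws. l) = a" using sum_list_scale[of a ws] sum1 by simp
      then show ?thesis using less.prems pos by (auto simp: cc_admissible_append)
    qed
    then have adm2: "cc_admissible ((vs @ map ?sc ws') @ [(a * b, p), (a * c, q)])"
      by (simp add: 3 xy)
    have "cc (vs @ map ?sc ws) = cc ((vs @ map ?sc ws') @ [(a * b, p), (a * c, q)])"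
      by (simp add: 3 xy)
    also have "\<dots> = cc ((vs @ map ?sc ws') @ [(a * b + a * c,
        cc [(a * b / (a * b + a * c), p), (a * c / (a * b + a * c), q)])])"
      using adm2 by (rule cc_associative)
    also have "\<dots> = cc (vs @ map ?sc ?ws)"
      using \<open>a > 0\<close> by (simp flip: distrib_left)
    also have "\<dots> = cc (vs @ [(a, cc ?ws)])"
      using less.prems(3) e1 by (intro less.hyps) (auto simp: 3 adm' \<open>a > 0\<close>)
    finally show ?thesis using e1 by simp
  qed
qed

lemma cc_two_blocks:
  assumes "0 < t" "t < 1" "cc_admissible ws" "cc_admissible vs"
  shows "cc (map (\<lambda>(l, u). (t * l, u)) ws @ map (\<lambda>(l, u). ((1 - t) * l, u)) vs)
      = cc [(t, cc ws), (1 - t, cc vs)]"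
proof -
  let ?W = "map (\<lambda>(l, u). (t * l, u)) ws"
  let ?V = "map (\<lambda>(l, u). ((1 - t) * l, u)) vs"
  have adm: "cc_admissible (?W @ ?V)" by (rule cc_admissible_scale[OF assms])
  have sW: "(\<Sum>(l, u) \<leftarrow> ?W. l) = t"
    using assms(3) by (simp only: sum_list_scale) (simp add: cc_admissible_def)
  have sV: "(\<Sum>(l, u) \<leftarrow> ?V. l) = 1 - t"
    using assms(4) by (simp only: sum_list_scale) (simp add: cc_admissible_def)
  have adm1: "cc_admissible (?W @ [(1 - t, cc vs)])"
    using adm sW assms(2) by (auto simp: cc_admissible_append)
  have "cc (?W @ ?V) = cc (?W @ [(1 - t, cc vs)])"
    by (rule cc_substitute[OF assms(4) _ adm1]) (use assms in auto)
  \<comment> \<open>\<open>cc_substitute\<close> acts only at the end of a list, so the blocks are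
    swapped before the second one is collapsed.\<close>
  also have "\<dots> = cc ([(1 - t, cc vs)] @ ?W)"
    by (rule cc_mset[symmetric]) (use adm1 in auto)
  also have "\<dots> = cc ([(1 - t, cc vs)] @ [(t, cc ws)])"
    by (rule cc_substitute[OF assms(3)]) (use assms in \<open>auto simp: cc_admissible_def\<close>)
  also have "\<dots> = cc [(t, cc ws), (1 - t, cc vs)]"
    by (rule cc_mset) (use assms in \<open>auto simp: cc_admissible_def\<close>)
  finally show ?thesis .
qed

text \<open>Extends the two-point inequality \<open>cc_dist\<close> to lists: the last two entries
  are merged simultaneously on both sides, and the merged pair costs at most what its two parts
  cost.\<close>

lemma dist_cc_le:
  assumes "cc_admissible (map (\<lambda>(l, x, y). (l, x)) ws)"
  shows "dist (cc (map (\<lambda>(l, x, y). (l, x)) ws)) (cc (map (\<lambda>(l, x, y). (l, y)) ws))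
      \<le> (\<Sum>(l, x, y) \<leftarrow> ws. l * dist x y)"
  using assms
proof (induction "length ws" arbitrary: ws rule: less_induct)
  case less
  let ?X = "\<lambda>ws. map (\<lambda>(l, x, y). (l, x :: 'a)) (ws :: (real \<times> 'a \<times> 'a) list)"
  let ?Y = "\<lambda>ws. map (\<lambda>(l, x, y). (l, y :: 'a)) (ws :: (real \<times> 'a \<times> 'a) list)"
  have s: "(\<Sum>(l, u) \<leftarrow> ?X ws. l) = (\<Sum>(l, u) \<leftarrow> ?Y ws. l)" for ws
    by (induction ws) auto
  have adY: "cc_admissible (?X ws) \<longleftrightarrow> cc_admissible (?Y ws)" for ws
    unfolding cc_admissible_def s by auto
  show ?case
  proof (cases ws rule: rev_cases2)
    case 1 then show ?thesis using less.prems by (simp add: cc_admissible_def)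
  next
    case (2 x)
    then show ?thesis using less.prems by (cases x) (auto simp: cc_admissible_def cc_singleton)
  next
    case (3 ws' x y)
    obtain b p p' c q q' where xy: "x = (b, p, p')" "y = (c, q, q')" by (cases x; cases y)
    have bc: "b > 0" "c > 0" using less.prems by (auto simp: 3 xy cc_admissible_def)
    let ?t = "b / (b + c)"
    have t: "0 < ?t" "?t < 1" "c / (b + c) = 1 - ?t" using bc by (auto simp: field_simps)
    define z where "z = cc [(b / (b + c), p), (c / (b + c), q)]"
    define z' where "z' = cc [(b / (b + c), p'), (c / (b + c), q')]"
    let ?ws = "ws' @ [(b + c, z, z')]"
    have ad: "cc_admissible (?X ?ws)" using less.prems(1) bc
      by (auto simp: 3 xy cc_admissible_append)
    have e1: "cc (?X ws) = cc (?X ?ws)"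
      using less.prems cc_associative[of "?X ws'" b p c q] by (simp add: 3 xy z_def)
    have e2: "cc (?Y ws) = cc (?Y ?ws)"
      using less.prems[unfolded adY] cc_associative[of "?Y ws'" b p' c q'] by (simp add: 3 xy z'_def)
    have "dist z z' \<le> ?t * dist p p' + (1 - ?t) * dist q q'"
      unfolding z_def z'_def t(3) by (rule cc_dist[OF t(1,2)])
    then have "(b + c) * dist z z' \<le> (b + c) * (?t * dist p p' + (1 - ?t) * dist q q')"
      using bc by (intro mult_left_mono) auto
    also have "\<dots> = b * dist p p' + c * dist q q'"
    proof -
      have "(b + c) * ?t = b" "(b + c) * (1 - ?t) = c" using bc by (auto simp: field_simps)
      then show ?thesis by (metis distrib_left mult.assoc)
    qed
    finally have le: "(b + c) * dist z z' \<le> b * dist p p' + c * dist q q'" .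
    have "dist (cc (?X ?ws)) (cc (?Y ?ws)) \<le> (\<Sum>(l, x, y) \<leftarrow> ?ws. l * dist x y)"
      by (rule less.hyps) (use ad in \<open>auto simp: 3\<close>)
    also have "\<dots> \<le> (\<Sum>(l, x, y) \<leftarrow> ws. l * dist x y)" using le by (simp add: 3 xy)
    finally show ?thesis unfolding e1 e2 .
  qed
qed

section \<open>The convexification operator and its fixed points\<close>

lemma cc_admissible_replicate: "n > 0 \<Longrightarrow> cc_admissible (replicate n (1 / real n, u))"
  by (auto simp: cc_admissible_def sum_list_replicate)

lemma cc_K_tendsto: "(\<lambda>n. cc (replicate n (1 / real n, u))) \<longlonglongrightarrow> cc_K cc u"
  using cc_convexification unfolding cc_K_def by (simp add: convergent_LIMSEQ_iff)

lemma dist_cc_K_le: "dist (cc_K cc u) (cc_K cc v) \<le> dist u v"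
proof (rule LIMSEQ_le_const2[OF tendsto_dist[OF cc_K_tendsto cc_K_tendsto]])
  have "dist (cc (replicate n (1 / real n, u))) (cc (replicate n (1 / real n, v))) \<le> dist u v"
    if "n \<ge> 1" for n
    using dist_cc_le[of "replicate n (1 / real n, u, v)"] that cc_admissible_replicate[of n u]
    by (simp add: sum_list_replicate del: One_nat_def)
  then show "\<exists>N. \<forall>n\<ge>N. dist (cc (replicate n (1 / real n, u))) (cc (replicate n (1 / real n, v))) \<le> dist u v"
    by blast
qed

text \<open>The equal-weight combination of \<open>m * (p + q)\<close> copies of \<open>u\<close>
  splits into blocks of \<open>m * p\<close> and \<open>m * q\<close> copies with total weights
  \<open>p / (p + q)\<close> and \<open>q / (p + q)\<close>. As \<open>m\<close> grows, the whole
  and both blocks converge to \<open>cc_K cc u\<close>, and \<open>cc_dist\<close> carries the limit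
  through the outer combination.\<close>

lemma cc_binary_cc_K_rat:
  assumes "0 < p" "0 < (q::nat)"
  shows "cc [(real p / real (p + q), cc_K cc u), (1 - real p / real (p + q), cc_K cc u)] = cc_K cc u"
proof -
  let ?U = "\<lambda>n. cc (replicate n (1 / real n, u))"
  let ?t = "real p / real (p + q)"
  have t: "0 < ?t" "?t < 1" using assms by (auto simp: field_simps)
  \<comment> \<open>The factor \<open>Suc n\<close> keeps the blocks nonempty for every
    \<open>n\<close>.\<close>
  have eq: "?U (Suc n * (p + q)) = cc [(?t, ?U (Suc n * p)), (1 - ?t, ?U (Suc n * q))]" for n
  proof -
    have 1: "?t * (1 / real (Suc n * p)) = 1 / real (Suc n * (p + q))"
      using assms by (simp add: divide_simps del: of_nat_Suc of_nat_add mult_Suc)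
    have 2: "(1 - ?t) * (1 / real (Suc n * q)) = 1 / real (Suc n * (p + q))"
      using assms by (simp add: divide_simps del: of_nat_Suc mult_Suc)
    have "cc [(?t, ?U (Suc n * p)), (1 - ?t, ?U (Suc n * q))]
        = cc (map (\<lambda>(l, u). (?t * l, u)) (replicate (Suc n * p) (1 / real (Suc n * p), u)) @
              map (\<lambda>(l, u). ((1 - ?t) * l, u)) (replicate (Suc n * q) (1 / real (Suc n * q), u)))"
      using t assms by (intro cc_two_blocks[symmetric] cc_admissible_replicate) simp_all
    also have "\<dots> = ?U (Suc n * (p + q))"
      unfolding map_replicate prod.case 1 2 by (simp add: replicate_add[symmetric] add_mult_distrib2)
    finally show ?thesis by simp
  qed
  have lim: "(\<lambda>n. ?U (Suc n * k)) \<longlonglongrightarrow> cc_K cc u" if "k > 0" for k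
  proof -
    have "strict_mono (\<lambda>n. Suc n * k)" using that by (intro strict_monoI) auto
    from LIMSEQ_subseq_LIMSEQ[OF cc_K_tendsto this] show ?thesis by (simp add: comp_def)
  qed
  let ?d = "\<lambda>n. ?t * dist (?U (Suc n * p)) (cc_K cc u) + (1 - ?t) * dist (?U (Suc n * q)) (cc_K cc u)"
  have "?d \<longlonglongrightarrow> ?t * dist (cc_K cc u) (cc_K cc u) + (1 - ?t) * dist (cc_K cc u) (cc_K cc u)"
    by (intro tendsto_intros lim assms)
  then have "?d \<longlonglongrightarrow> 0" by simp
  have le: "dist (?U (Suc n * (p + q))) (cc [(?t, cc_K cc u), (1 - ?t, cc_K cc u)]) \<le> ?d n" for n
    unfolding eq by (rule cc_dist[OF t])
  have "(\<lambda>n. ?U (Suc n * (p + q))) \<longlonglongrightarrow> cc [(?t, cc_K cc u), (1 - ?t, cc_K cc u)]"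
    by (rule tendsto_dist_squeeze[OF \<open>?d \<longlonglongrightarrow> 0\<close> always_eventually]) (intro allI le)
  moreover have "(\<lambda>n. ?U (Suc n * (p + q))) \<longlonglongrightarrow> cc_K cc u"
    using assms by (intro lim) simp
  ultimately show ?thesis by (rule LIMSEQ_unique)
qed

text \<open>Rational weights are dense and the combination is constant along them, so continuity in
  the weight settles every real \<open>t\<close>.\<close>

lemma cc_binary_cc_K:
  assumes "0 < t" "t < 1"
  shows "cc [(t, cc_K cc u), (1 - t, cc_K cc u)] = cc_K cc u"
proof -
  \<comment> \<open>Since the floor of \<open>t * (k + 2)\<close> lies between 0 and
    \<open>k + 1\<close>, adding 1 to the numerator and dividing by \<open>k + 3\<close> puts
    \<open>ts k\<close> strictly inside the unit interval, as \<open>cc_continuous\<close> demands,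
    and still within \<open>2 / (k + 3)\<close> of \<open>t\<close>.\<close>
  define ts where "ts k = real (nat \<lfloor>t * real (k + 2)\<rfloor> + 1) / real (k + 3)" for k :: nat
  have b: "nat \<lfloor>t * real (k + 2)\<rfloor> < k + 2" for k
  proof -
    have "t * real (k + 2) < 1 * real (k + 2)" using assms by (intro mult_strict_right_mono) auto
    then have "\<lfloor>t * real (k + 2)\<rfloor> < int (k + 2)" by (simp add: floor_less_iff)
    then show ?thesis by simp
  qed
  have eqK: "cc [(ts k, cc_K cc u), (1 - ts k, cc_K cc u)] = cc_K cc u"
    and ts01: "0 < ts k \<and> ts k < 1" for k
  proof -
    let ?p = "nat \<lfloor>t * real (k + 2)\<rfloor> + 1"
    have "?p < k + 3" using b[of k] by linarith
    then have *: "?p + (k + 3 - ?p) = k + 3" "k + 3 - ?p > 0" by auto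
    show "cc [(ts k, cc_K cc u), (1 - ts k, cc_K cc u)] = cc_K cc u"
      using cc_binary_cc_K_rat[of ?p "k + 3 - ?p" u] * unfolding ts_def by (simp add: add.commute)
    show "0 < ts k \<and> ts k < 1" using b[of k] unfolding ts_def by (simp add: field_simps)
  qed
  have "ts \<longlonglongrightarrow> t"
  proof (rule LIMSEQ_I)
    fix r :: real assume "r > 0"
    have d: "norm (ts k - t) \<le> 2 / real (k + 3)" for k
    proof -
      have "\<lfloor>t * real (k + 2)\<rfloor> \<ge> 0" using assms by simp
      then have "real (nat \<lfloor>t * real (k + 2)\<rfloor>) = of_int \<lfloor>t * real (k + 2)\<rfloor>" by simp
      then have "\<bar>real (nat \<lfloor>t * real (k + 2)\<rfloor> + 1) - t * real (k + 3)\<bar> \<le> 2"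
        using assms floor_correct[of "t * real (k + 2)"] by (simp add: algebra_simps) linarith
      moreover have "ts k - t = (real (nat \<lfloor>t * real (k + 2)\<rfloor> + 1) - t * real (k + 3)) / real (k + 3)"
        unfolding ts_def by (simp add: field_simps)
      ultimately show ?thesis by (simp add: divide_right_mono)
    qed
    obtain N where "real N > 2 / r" using reals_Archimedean2 by blast
    then have "2 / real (k + 3) < r" if "k \<ge> N" for k
    proof -
      have "2 / r < real (k + 3)" using \<open>real N > 2 / r\<close> that by linarith
      then show ?thesis using \<open>r > 0\<close> by (simp add: field_simps)
    qed
    then show "\<exists>no. \<forall>n\<ge>no. norm (ts n - t) < r" using d by (meson le_less_trans)
  qed
  then have "(\<lambda>k. cc [(ts k, cc_K cc u), (1 - ts k, cc_K cc u)]) \<longlonglongrightarrow> cc [(t, cc_K cc u), (1 - t, cc_K cc u)]"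
    by (rule cc_continuous[OF ts01 assms])
  then show ?thesis unfolding eqK by (simp add: LIMSEQ_const_iff)
qed

end

section \<open>Total weights of points and the normal form of a combination\<close>

definition cc_weight :: "(real \<times> 'a) list \<Rightarrow> 'a \<Rightarrow> real" where
  "cc_weight ws x = (\<Sum>(l, y) \<leftarrow> ws. if y = x then l else 0)"

lemma cc_weight_Nil [simp]: "cc_weight [] x = 0"
  and cc_weight_Cons [simp]: "cc_weight ((l, y) # ws) x = (if y = x then l else 0) + cc_weight ws x"
  and cc_weight_append [simp]: "cc_weight (ws @ vs) x = cc_weight ws x + cc_weight vs x"
  by (auto simp: cc_weight_def)

lemma cc_weight_filter: "cc_weight (filter (\<lambda>(l, u). l \<noteq> 0) ws) x = cc_weight ws x"
  by (induction ws) auto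

lemma cc_weight_nonneg: "\<forall>(l, u) \<in> set ws. l \<ge> 0 \<Longrightarrow> cc_weight ws x \<ge> 0"
  by (induction ws) auto

text \<open>With positive weights, the weight function determines which points occur; this lets
  \<open>cc_eqI_weight\<close> use one common list of points for both sides.\<close>

lemma cc_weight_pos_iff:
  "\<forall>(l, u) \<in> set ws. l > 0 \<Longrightarrow> cc_weight ws x > 0 \<longleftrightarrow> x \<in> snd ` set ws"
proof (induction ws)
  case (Cons a ws)
  have "cc_weight ws x \<ge> 0" using Cons.prems by (intro cc_weight_nonneg) force
  then show ?case using Cons by (cases a) (auto simp: add_pos_nonneg)
qed simp

lemma cc_weight_eq_0: "x \<notin> snd ` set ws \<Longrightarrow> cc_weight ws x = 0"
  by (induction ws) auto

lemma cc_weight_distinct: "distinct (map snd ws) \<Longrightarrow> (l, x) \<in> set ws \<Longrightarrow> cc_weight ws x = l"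
proof (induction ws)
  case (Cons a ws)
  obtain k y where a: "a = (k, y)" by (cases a)
  show ?case
  proof (cases "y = x")
    case True
    with Cons.prems a have "x \<notin> snd ` set ws" by auto
    then have "(l, x) \<notin> set ws" by force
    then show ?thesis using Cons.prems a True \<open>x \<notin> snd ` set ws\<close> by (auto simp: cc_weight_eq_0)
  next
    case False
    then show ?thesis using Cons a by auto
  qed
qed simp

lemma cc_weight_map:
  assumes "distinct zs"
  shows "cc_weight (map (\<lambda>i. (w i, g i)) zs) x = (\<Sum>i\<in>set zs. if g i = x then w i else 0)"
  unfolding cc_weight_def by (simp add: comp_def sum_list_distinct_conv_sum_set assms)

lemma map_eq_appendE:
  assumes "map f xs = ys @ zs"
  obtains us vs where "xs = us @ vs" "map f us = ys" "map f vs = zs"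
  using assms unfolding map_eq_append_conv by auto

context cc_space
begin

text \<open>Two entries at the same point \<open>y\<close> are moved to the end and merged by
  associativity. Their inner combination is \<open>y\<close> again because \<open>y\<close> is a
  value of K, so the list gets shorter while its weight function stays the same. A list without
  repetitions is already the normal form up to order.\<close>

lemma cc_normal_form:
  assumes "cc_admissible ws" "snd ` set ws \<subseteq> range (cc_K cc)" "distinct xs" "set xs = snd ` set ws"
  shows "cc ws = cc (map (\<lambda>x. (cc_weight ws x, x)) xs)"
  using assms
proof (induction "length ws" arbitrary: ws rule: less_induct)
  case less
  show ?case
  proof (cases "distinct (map snd ws)")
    case True
    let ?f = "\<lambda>x. (cc_weight ws x, x)"
    have "map ?f (map snd ws) = ws"
      unfolding map_map using cc_weight_distinct[OF True] by (intro map_idI) (auto simp: comp_def)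
    then have "mset ws = image_mset ?f (mset (map snd ws))" by (metis mset_map)
    also have "mset (map snd ws) = mset xs"
      using True less.prems by (subst set_eq_iff_mset_eq_distinct[symmetric]) auto
    finally have "mset (map (\<lambda>x. (cc_weight ws x, x)) xs) = mset ws" by simp
    then show ?thesis by (rule cc_mset[OF less.prems(1), symmetric])
  next
    case False
    from not_distinct_decomp[OF this] obtain as bs cs y
      where "map snd ws = as @ y # bs @ y # cs" by auto
    then obtain A Z where AZ: "ws = A @ Z" "map snd Z = y # bs @ y # cs"
      by (rule map_eq_appendE)
    then obtain a R where Z: "Z = (a, y) # R" "map snd R = bs @ y # cs" by (cases Z) auto
    from Z(2) obtain B Z' where R: "R = B @ Z'" "map snd Z' = y # cs"
      by (rule map_eq_appendE)
    then obtain b C where "Z' = (b, y) # C" by (cases Z') auto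
    with AZ Z R have ws: "ws = A @ [(a, y)] @ B @ [(b, y)] @ C" by simp
    let ?vs = "A @ B @ C"
    let ?ws = "?vs @ [(a, y), (b, y)]"
    have m: "mset ?ws = mset ws" by (simp add: ws)
    have adm: "cc_admissible ?ws" using less.prems(1) cc_admissible_mset[OF m] by simp
    have ab: "a > 0" "b > 0" using less.prems(1) by (auto simp: ws cc_admissible_def)
    have y: "y \<in> range (cc_K cc)" using less.prems by (auto simp: ws)
    have adm': "cc_admissible (?vs @ [(a + b, y)])" using adm ab by (auto simp: cc_admissible_append)
    have q: "b / (a + b) = 1 - a / (a + b)" "0 < a / (a + b)" "a / (a + b) < 1"
      using ab by (auto simp: field_simps)
    have "cc ws = cc ?ws" by (rule cc_mset[OF less.prems(1) m, symmetric])
    also have "\<dots> = cc (?vs @ [(a + b, cc [(a / (a + b), y), (b / (a + b), y)])])"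
      using adm by (rule cc_associative)
    also have "cc [(a / (a + b), y), (b / (a + b), y)] = y"
      using y cc_binary_cc_K[OF q(2,3)] unfolding q(1) by auto
    also have "cc (?vs @ [(a + b, y)]) = cc (map (\<lambda>x. (cc_weight (?vs @ [(a + b, y)]) x, x)) xs)"
      using less.prems by (intro less.hyps adm') (auto simp: ws)
    also have "cc_weight (?vs @ [(a + b, y)]) = cc_weight ws" by (auto simp: ws)
    finally show ?thesis .
  qed
qed

lemma cc_eqI_weight:
  assumes "cc_admissible ws" "snd ` set ws \<subseteq> range (cc_K cc)"
    and "cc_admissible vs" "snd ` set vs \<subseteq> range (cc_K cc)"
    and "cc_weight ws = cc_weight vs"
  shows "cc ws = cc vs"
proof -
  have "x \<in> snd ` set ws \<longleftrightarrow> x \<in> snd ` set vs" for x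
    using assms(1,3,5) cc_weight_pos_iff[of ws x] cc_weight_pos_iff[of vs x]
    unfolding cc_admissible_def by simp
  then have "snd ` set ws = snd ` set vs" by (rule set_eqI)
  moreover obtain xs where "set xs = snd ` set ws" "distinct xs"
    using finite_distinct_list[of "snd ` set ws"] by auto
  ultimately show ?thesis using cc_normal_form[of ws xs] cc_normal_form[of vs xs] assms by simp
qed

section \<open>Barycentres of finite weight systems, couplings and continuity\<close>

lemma cc_admissible_filter:
  assumes "distinct xs" "\<forall>x\<in>set xs. p x \<ge> 0" "(\<Sum>x\<in>set xs. p x) = 1"
  shows "cc_admissible (filter (\<lambda>(l, u). l \<noteq> 0) (map (\<lambda>x. (p x, g x)) xs))"
proof -
  have "(\<Sum>(l, u)\<leftarrow>filter (\<lambda>(l, u). l \<noteq> 0) (map (\<lambda>x. (p x, g x)) xs). l) = (\<Sum>x\<leftarrow>xs. p x)"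
    by (induction xs) auto
  also have "\<dots> = 1" using assms by (simp add: sum_list_distinct_conv_sum_set)
  finally show ?thesis using assms by (fastforce simp: cc_admissible_def)
qed

text \<open>The weights \<open>p\<close> are the image of the weights \<open>w\<close> under
  \<open>f\<close>. Both lists give the same total weight to every point of the space, even where K
  identifies several points, so \<open>cc_eqI_weight\<close> applies.\<close>

lemma cc_comb0_reindex:
  assumes "distinct xs" "\<forall>x\<in>set xs. p x \<ge> 0" "(\<Sum>x\<in>set xs. p x) = 1"
    and "distinct zs" "\<forall>z\<in>set zs. w z \<ge> 0" "\<And>x. x \<in> set xs \<Longrightarrow> (\<Sum>z | z \<in> set zs \<and> f z = x. w z) = p x"
    and "f ` set zs \<subseteq> set xs"
  shows "cc_comb0 cc (map (\<lambda>z. (w z, cc_K cc (f z))) zs) = cc_comb0 cc (map (\<lambda>x. (p x, cc_K cc x)) xs)"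
  unfolding cc_comb0_def
proof (rule cc_eqI_weight)
  \<comment> \<open>Change of variables with a test function \<open>h\<close>: \<open>h = 1\<close>
    yields total mass 1, and the indicator of \<open>cc_K cc x = y\<close> yields the weight at
    \<open>y\<close>.\<close>
  have g: "(\<Sum>z\<in>set zs. h (f z) * w z) = (\<Sum>x\<in>set xs. h x * p x)" for h :: "'a \<Rightarrow> real"
  proof -
    have "(\<Sum>x\<in>set xs. h x * p x) = (\<Sum>x\<in>set xs. \<Sum>z | z \<in> set zs \<and> f z = x. h (f z) * w z)"
      by (intro sum.cong refl) (simp add: assms(6)[symmetric] sum_distrib_left)
    also have "\<dots> = (\<Sum>z\<in>set zs. h (f z) * w z)" by (rule sum.group) (use assms(7) in auto)
    finally show ?thesis by simp
  qed
  show "cc_admissible (filter (\<lambda>(l, u). l \<noteq> 0) (map (\<lambda>z. (w z, cc_K cc (f z))) zs))"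
    by (rule cc_admissible_filter) (use assms g[of "\<lambda>_. 1"] in auto)
  show "cc_admissible (filter (\<lambda>(l, u). l \<noteq> 0) (map (\<lambda>x. (p x, cc_K cc x)) xs))"
    by (rule cc_admissible_filter) (use assms in auto)
  show "cc_weight (filter (\<lambda>(l, u). l \<noteq> 0) (map (\<lambda>z. (w z, cc_K cc (f z))) zs)) =
      cc_weight (filter (\<lambda>(l, u). l \<noteq> 0) (map (\<lambda>x. (p x, cc_K cc x)) xs))"
  proof
    fix y
    show "cc_weight (filter (\<lambda>(l, u). l \<noteq> 0) (map (\<lambda>z. (w z, cc_K cc (f z))) zs)) y =
      cc_weight (filter (\<lambda>(l, u). l \<noteq> 0) (map (\<lambda>x. (p x, cc_K cc x)) xs)) y"
      unfolding cc_weight_filter cc_weight_map[OF assms(1)] cc_weight_map[OF assms(4)]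
      using g[of "\<lambda>x. if cc_K cc x = y then 1 else 0"] by (simp add: if_distrib[of "\<lambda>x. x * _"] cong: if_cong)
  qed
qed auto

text \<open>The enumeration of \<open>A\<close> is chosen by the same description as in
  \<open>cc_simple_cond_exp\<close>, so the two expressions agree literally when \<open>A\<close> is
  the set of values. For nonnegative weights of sum 1 the chosen order does not affect the
  result.\<close>

definition barycentre :: "'a set \<Rightarrow> ('a \<Rightarrow> real) \<Rightarrow> 'a" where
  "barycentre A p = cc_comb0 cc (map (\<lambda>x. (p x, cc_K cc x)) (SOME xs. distinct xs \<and> set xs = A))"

lemma some_list:
  assumes "finite A"
  shows "distinct (SOME xs. distinct xs \<and> set xs = A)" "set (SOME xs. distinct xs \<and> set xs = A) = A"
  using someI_ex[of "\<lambda>xs. distinct xs \<and> set xs = A"] finite_distinct_list[OF assms] by auto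

text \<open>\<open>r\<close> is a coupling of \<open>p\<close> and \<open>q\<close>. Reindexing
  along the two projections of \<open>A \<times> B\<close> writes both barycentres as combinations
  with the same weights \<open>r x y\<close>. The distance is then estimated entry by entry, and K
  does not increase distances.\<close>

lemma dist_barycentre_le:
  assumes fin: "finite A" "finite B"
    and r: "\<And>x y. x \<in> A \<Longrightarrow> y \<in> B \<Longrightarrow> r x y \<ge> 0"
    and p: "\<And>x. x \<in> A \<Longrightarrow> (\<Sum>y\<in>B. r x y) = p x"
    and q: "\<And>y. y \<in> B \<Longrightarrow> (\<Sum>x\<in>A. r x y) = q y"
    and one: "(\<Sum>x\<in>A. p x) = 1"
  shows "dist (barycentre A p) (barycentre B q) \<le> (\<Sum>x\<in>A. \<Sum>y\<in>B. r x y * dist x y)"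
proof -
  obtain zs where zs: "distinct zs" "set zs = A \<times> B"
    using finite_distinct_list[OF finite_cartesian_product[OF fin]] by auto
  let ?w = "\<lambda>(x, y). r x y"
  have rq: "(\<Sum>y\<in>B. q y) = 1"
    using one by (simp add: p[symmetric] q[symmetric] sum.swap[of _ A B])
  have pn: "\<forall>x\<in>A. p x \<ge> 0" using r p by (metis sum_nonneg)
  have qn: "\<forall>y\<in>B. q y \<ge> 0" using r q by (metis sum_nonneg)
  have f1: "(\<Sum>z | z \<in> A \<times> B \<and> fst z = x. ?w z) = p x" if "x \<in> A" for x
  proof -
    have "{z \<in> A \<times> B. fst z = x} = Pair x ` B" using that by auto
    then show ?thesis using p[OF that] by (simp add: sum.reindex inj_on_def)
  qed
  have f2: "(\<Sum>z | z \<in> A \<times> B \<and> snd z = y. ?w z) = q y" if "y \<in> B" for y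
  proof -
    have "{z \<in> A \<times> B. snd z = y} = (\<lambda>x. (x, y)) ` A" using that by auto
    then show ?thesis using q[OF that] by (simp add: sum.reindex inj_on_def)
  qed
  define ws where "ws = map (\<lambda>(x, y). (r x y, cc_K cc x, cc_K cc y)) (filter (\<lambda>(x, y). r x y \<noteq> 0) zs)"
  have e1: "filter (\<lambda>(l, u). l \<noteq> 0) (map (\<lambda>z. (?w z, cc_K cc (fst z))) zs) = map (\<lambda>(l, x, y). (l, x)) ws"
    and e2: "filter (\<lambda>(l, u). l \<noteq> 0) (map (\<lambda>z. (?w z, cc_K cc (snd z))) zs) = map (\<lambda>(l, x, y). (l, y)) ws"
    unfolding ws_def by (induction zs) auto
  have "barycentre A p = cc_comb0 cc (map (\<lambda>z. (?w z, cc_K cc (fst z))) zs)"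
    unfolding barycentre_def
    by (rule cc_comb0_reindex[symmetric]) (use some_list[OF fin(1)] pn one r zs f1 in auto)
  then have b1: "barycentre A p = cc (map (\<lambda>(l, x, y). (l, x)) ws)"
    unfolding cc_comb0_def e1 .
  have "barycentre B q = cc_comb0 cc (map (\<lambda>z. (?w z, cc_K cc (snd z))) zs)"
    unfolding barycentre_def
    by (rule cc_comb0_reindex[symmetric]) (use some_list[OF fin(2)] qn rq r zs f2 in auto)
  then have b2: "barycentre B q = cc (map (\<lambda>(l, x, y). (l, y)) ws)"
    unfolding cc_comb0_def e2 .
  have "cc_admissible (map (\<lambda>(l, x, y). (l, x)) ws)"
    unfolding e1[symmetric] using zs r one p
    by (intro cc_admissible_filter) (auto simp: sum.cartesian_product[symmetric])
  from dist_cc_le[OF this] have "dist (barycentre A p) (barycentre B q) \<le> (\<Sum>(l, x, y)\<leftarrow>ws. l * dist x y)"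
    unfolding b1 b2 .
  also have "\<dots> = (\<Sum>(x, y)\<leftarrow>zs. r x y * dist (cc_K cc x) (cc_K cc y))"
    unfolding ws_def by (induction zs) auto
  also have "\<dots> = (\<Sum>(x, y)\<in>A \<times> B. r x y * dist (cc_K cc x) (cc_K cc y))"
    by (simp add: sum_list_distinct_conv_sum_set zs)
  also have "\<dots> \<le> (\<Sum>(x, y)\<in>A \<times> B. r x y * dist x y)"
    using r dist_cc_K_le by (intro sum_mono) (auto intro!: mult_left_mono)
  finally show ?thesis by (simp add: sum.cartesian_product)
qed

lemma barycentre_singleton: "p z = 1 \<Longrightarrow> barycentre {z} p = cc_K cc z"
proof -
  assume "p z = 1"
  have *: "xs = [z]" if "distinct xs" "set xs = {z}" for xs
    using that by (cases xs; cases "tl xs") auto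
  have "(SOME xs. distinct xs \<and> set xs = {z}) = [z]"
    using some_list[of "{z}"] by (intro *) auto
  then show ?thesis unfolding barycentre_def cc_comb0_def by (simp add: \<open>p z = 1\<close> cc_singleton)
qed

text \<open>A system of weights has only one coupling with a point mass, and its cost is the mean
  distance to \<open>z\<close>.\<close>

lemma dist_barycentre_point_le:
  assumes "finite A" "\<And>x. x \<in> A \<Longrightarrow> p x \<ge> 0" "(\<Sum>x\<in>A. p x) = 1"
  shows "dist (barycentre A p) (cc_K cc z) \<le> (\<Sum>x\<in>A. p x * dist x z)"
  using dist_barycentre_le[of A "{z}" "\<lambda>x _. p x" p "\<lambda>_. 1"] assms by (simp add: barycentre_singleton)

text \<open>Mass shared by \<open>p\<close> and \<open>q\<close> stays where it is and costs
  nothing; only the excess \<delta> travels, over a distance of at most \<open>D\<close>. This is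
  the quantitative form of continuity in the weights.\<close>

lemma dist_barycentre_weights_le:
  assumes fin: "finite A"
    and p: "\<And>x. x \<in> A \<Longrightarrow> p x \<ge> 0" "(\<Sum>x\<in>A. p x) = 1"
    and q: "\<And>x. x \<in> A \<Longrightarrow> q x \<ge> 0" "(\<Sum>x\<in>A. q x) = 1"
    and D: "\<And>x y. x \<in> A \<Longrightarrow> y \<in> A \<Longrightarrow> dist x y \<le> D"
  shows "dist (barycentre A p) (barycentre A q) \<le> D * (\<Sum>x\<in>A. \<bar>p x - q x\<bar>)"
proof -
  define m where "m x = min (p x) (q x)" for x
  define \<delta> where "\<delta> = (\<Sum>x\<in>A. p x - m x)"
  have \<delta>q: "\<delta> = (\<Sum>x\<in>A. q x - m x)" using p(2) q(2) by (simp add: \<delta>_def sum_subtractf)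
  \<comment> \<open>In fact \<delta> is half of this sum; the factor does not matter for
    continuity.\<close>
  have \<delta>_le: "\<delta> \<le> (\<Sum>x\<in>A. \<bar>p x - q x\<bar>)" unfolding \<delta>_def m_def by (intro sum_mono) auto
  have m: "m x \<le> p x" "m x \<le> q x" for x by (auto simp: m_def)
  have "\<delta> \<ge> 0" unfolding \<delta>_def using m by (intro sum_nonneg) auto
  obtain a where "a \<in> A" using p(2) by fastforce
  then have "D \<ge> 0" using D[of a a] by simp
  \<comment> \<open>The coupling that leaves the common part \<open>m\<close> of the weights in place and distributes the
    remainders independently; for \<open>\<delta> = 0\<close> the remainders vanish, so the division is harmless.\<close>
  define r where "r x y = (if x = y then m x else 0) + (p x - m x) * (q y - m y) / \<delta>" for x y
  have zero: "p x - m x = 0" "q x - m x = 0" if "\<delta> = 0" "x \<in> A" for x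
  proof -
    show "p x - m x = 0" using that m sum_nonneg_eq_0_iff[OF fin, of "\<lambda>x. p x - m x"] unfolding \<delta>_def by auto
    show "q x - m x = 0" using that m sum_nonneg_eq_0_iff[OF fin, of "\<lambda>x. q x - m x"] unfolding \<delta>q by auto
  qed
  have "dist (barycentre A p) (barycentre A q) \<le> (\<Sum>x\<in>A. \<Sum>y\<in>A. r x y * dist x y)"
  proof (rule dist_barycentre_le[OF fin fin])
    show "r x y \<ge> 0" if "x \<in> A" "y \<in> A" for x y
      unfolding r_def using that p q m \<open>\<delta> \<ge> 0\<close> by (auto simp: m_def)
    show "(\<Sum>y\<in>A. r x y) = p x" if "x \<in> A" for x
    proof -
      have "(\<Sum>y\<in>A. r x y) = m x + (p x - m x) * \<delta> / \<delta>"
        unfolding r_def \<delta>q using that fin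
        by (simp add: sum.distrib sum_distrib_left[symmetric] sum_divide_distrib[symmetric])
      also have "\<dots> = p x" using zero(1)[OF _ that] by (cases "\<delta> = 0") auto
      finally show ?thesis .
    qed
    show "(\<Sum>x\<in>A. r x y) = q y" if "y \<in> A" for y
    proof -
      have "(\<Sum>x\<in>A. r x y) = m y + \<delta> * (q y - m y) / \<delta>"
        unfolding r_def \<delta>_def using that fin
        by (simp add: sum.distrib sum_distrib_right[symmetric] sum_divide_distrib[symmetric])
      also have "\<dots> = q y" using zero(2)[OF _ that] by (cases "\<delta> = 0") auto
      finally show ?thesis .
    qed
  qed (rule p(2))
  also have "\<dots> \<le> (\<Sum>x\<in>A. \<Sum>y\<in>A. (p x - m x) * (q y - m y) / \<delta> * D)"
  proof (intro sum_mono)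
    fix x y assume "x \<in> A" "y \<in> A"
    have "r x y * dist x y = (p x - m x) * (q y - m y) / \<delta> * dist x y" by (simp add: r_def)
    also have "\<dots> \<le> (p x - m x) * (q y - m y) / \<delta> * D"
      using D \<open>x \<in> A\<close> \<open>y \<in> A\<close> m \<open>\<delta> \<ge> 0\<close> by (intro mult_left_mono) auto
    finally show "r x y * dist x y \<le> (p x - m x) * (q y - m y) / \<delta> * D" .
  qed
  also have "\<dots> = \<delta> * \<delta> / \<delta> * D"
    unfolding sum_divide_distrib[symmetric] sum_distrib_right[symmetric] sum_product[symmetric]
    by (simp only: \<delta>_def[symmetric] \<delta>q[symmetric])
  also have "\<dots> = D * \<delta>" by simp
  also have "\<dots> \<le> D * (\<Sum>x\<in>A. \<bar>p x - q x\<bar>)" using \<delta>_le \<open>D \<ge> 0\<close> by (rule mult_left_mono)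
  finally show ?thesis .
qed

text \<open>Stated for an arbitrary filter because it serves twice: along sequences of conditional
  probabilities, and at points of the simplex, where it gives the continuity behind
  measurability.\<close>

lemma tendsto_barycentre:
  assumes fin: "finite A"
    and p: "\<forall>\<^sub>F k in F. (\<forall>x\<in>A. p k x \<ge> 0) \<and> (\<Sum>x\<in>A. p k x) = 1"
    and q: "\<forall>x\<in>A. q x \<ge> 0" "(\<Sum>x\<in>A. q x) = 1"
    and lim: "\<And>x. x \<in> A \<Longrightarrow> ((\<lambda>k. p k x) \<longlongrightarrow> q x) F"
  shows "((\<lambda>k. barycentre A (p k)) \<longlongrightarrow> barycentre A q) F"
proof (rule tendsto_dist_squeeze)
  define D where "D = (\<Sum>(x, y)\<in>A \<times> A. dist x y)"
  have D: "dist x y \<le> D" if "x \<in> A" "y \<in> A" for x y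
    unfolding D_def using member_le_sum[of "(x, y)" "A \<times> A" "\<lambda>(x, y). dist x y"] that fin by auto
  have "((\<lambda>k. D * (\<Sum>x\<in>A. \<bar>p k x - q x\<bar>)) \<longlongrightarrow> D * (\<Sum>x\<in>A. \<bar>q x - q x\<bar>)) F"
    by (intro tendsto_intros lim)
  then show "((\<lambda>k. D * (\<Sum>x\<in>A. \<bar>p k x - q x\<bar>)) \<longlongrightarrow> 0) F" by simp
  show "\<forall>\<^sub>F k in F. dist (barycentre A (p k)) (barycentre A q) \<le> D * (\<Sum>x\<in>A. \<bar>p k x - q x\<bar>)"
    using p by eventually_elim (intro dist_barycentre_weights_le, use fin q D in auto)
qed

end

text \<open>The barycentre is a continuous function of the weights on the simplex only, so its
  composition with the weights is measurable on the event where they lie there; elsewhere the value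
  is constant. Coordinates are numbered by naturals because coordinatewise measurability gives Borel
  measurability for countable index types, while \<open>A\<close> may sit in an uncountable
  type.\<close>

lemma measurable_barycentre:
  fixes cc :: "(real \<times> 'a::polish_space) list \<Rightarrow> 'a"
  assumes "cc_space cc" and fin: "finite A"
    and p: "\<And>x. x \<in> A \<Longrightarrow> (\<lambda>\<omega>. p \<omega> x) \<in> borel_measurable N"
  shows "(\<lambda>\<omega>. if (\<forall>x\<in>A. p \<omega> x \<ge> 0) \<and> (\<Sum>x\<in>A. p \<omega> x) = 1
      then cc_space.barycentre cc A (p \<omega>) else c) \<in> borel_measurable N"
proof -
  interpret cc_space cc by fact
  obtain idx :: "'a \<Rightarrow> nat" and n where idx: "bij_betw idx A {..<n}"
    using ex_bij_betw_finite_nat[OF fin] by (auto simp: atLeast0LessThan)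
  define S :: "(nat \<Rightarrow> real) set" where "S = {w. (\<forall>x\<in>A. w (idx x) \<ge> 0) \<and> (\<Sum>x\<in>A. w (idx x)) = 1}"
  define g where "g w = barycentre A (\<lambda>x. w (idx x))" for w
  have cont: "continuous_on S g"
    unfolding continuous_on_def
  proof
    fix w assume w: "w \<in> S"
    show "(g \<longlongrightarrow> g w) (at w within S)"
      unfolding g_def
    proof (rule tendsto_barycentre[OF fin])
      show "\<forall>\<^sub>F v in at w within S. (\<forall>x\<in>A. v (idx x) \<ge> 0) \<and> (\<Sum>x\<in>A. v (idx x)) = 1"
        unfolding eventually_at_topological S_def by auto
      show "\<forall>x\<in>A. w (idx x) \<ge> 0" "(\<Sum>x\<in>A. w (idx x)) = 1" using w by (auto simp: S_def)
      have "continuous_on S (\<lambda>v :: nat \<Rightarrow> real. v i)" for i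
        by (rule continuous_on_subset[OF continuous_on_product_coordinates]) simp
      then show "((\<lambda>v. v (idx x)) \<longlongrightarrow> w (idx x)) (at w within S)" for x
        using w unfolding continuous_on_def by blast
    qed
  qed
  let ?P = "\<lambda>\<omega>. (\<forall>x\<in>A. p \<omega> x \<ge> 0) \<and> (\<Sum>x\<in>A. p \<omega> x) = 1"
  define W where "W \<omega> = (\<lambda>i. if i < n then p \<omega> (inv_into A idx i) else 0)" for \<omega>
  have inv: "inv_into A idx (idx x) = x" "idx x < n" if "x \<in> A" for x
    using idx that by (auto simp: bij_betw_def)
  have W: "W \<omega> (idx x) = p \<omega> x" if "x \<in> A" for \<omega> x using inv[OF that] by (simp add: W_def)
  have Pm: "{\<omega> \<in> space N. ?P \<omega>} \<in> sets N"
    using p fin by measurable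
  have "(\<lambda>\<omega>. W \<omega> i) \<in> borel_measurable N" for i
  proof (cases "i < n")
    case True
    then have "inv_into A idx i \<in> A" using idx by (metis bij_betw_imp_surj_on inv_into_into lessThan_iff)
    then show ?thesis using p True by (simp add: W_def)
  qed (simp add: W_def)
  then have Wm: "W \<in> borel_measurable N" by (rule measurable_coordinatewise_then_product)
  have "W \<in> measurable (restrict_space N {\<omega>. ?P \<omega>}) (restrict_space borel S)"
  proof (rule measurable_restrict_space2)
    show "W \<in> space (restrict_space N {\<omega>. ?P \<omega>}) \<rightarrow> S"
      using W by (auto simp: space_restrict_space S_def)
    show "W \<in> borel_measurable (restrict_space N {\<omega>. ?P \<omega>})"
      by (rule measurable_restrict_space1[OF Wm])
  qed
  then have "(\<lambda>\<omega>. g (W \<omega>)) \<in> borel_measurable (restrict_space N {\<omega>. ?P \<omega>})"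
    by (rule measurable_compose[OF _ borel_measurable_continuous_on_restrict[OF cont]])
  moreover have "barycentre A (W' \<circ> idx) = g W'" for W' by (simp add: g_def comp_def)
  moreover have "barycentre A (p \<omega>) = g (W \<omega>)" for \<omega>
    unfolding g_def barycentre_def using some_list(2)[OF fin] W
    by (intro arg_cong[of _ _ "cc_comb0 cc"] map_cong) auto
  ultimately show ?thesis
    by (subst measurable_If_restrict_space_iff[OF Pm]) (auto intro: measurable_const)
qed

section \<open>Levy's theorems\<close>

context prob_space
begin

lemma finite_measure_subalgebraI: "subalgebra M G \<Longrightarrow> finite_measure_subalgebra M G"
  by (simp add: finite_measure_subalgebra_axioms_def finite_measure_subalgebra_def finite_measure_axioms)

text \<open>\<open>A k\<close> is the event that level \<open>c\<close> is first exceeded at time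
  \<open>k\<close>. It belongs to \<open>G k\<close>, so \<open>h\<close> and its conditional
  expectation, which exceeds \<open>c\<close> there, have the same integral over it. These events
  are disjoint, and summing over \<open>k\<close> uses at most the whole integral of
  \<open>h\<close>.\<close>

lemma doob_maximal_finite:
  fixes N :: nat
  assumes sub: "\<And>k. k \<le> N \<Longrightarrow> subalgebra M (G k)"
    and mono: "\<And>j k. j \<le> k \<Longrightarrow> k \<le> N \<Longrightarrow> sets (G j) \<subseteq> sets (G k)"
    and h: "integrable M h" "\<And>\<omega>. h \<omega> \<ge> 0" and "c > 0"
  shows "c * prob {\<omega> \<in> space M. \<exists>k\<le>N. real_cond_exp M (G k) h \<omega> > c} \<le> (\<integral>\<omega>. h \<omega> \<partial>M)"
proof -
  define g where "g k = real_cond_exp M (G k) h" for k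
  define A where "A k = {\<omega> \<in> space M. g k \<omega> > c \<and> (\<forall>j\<in>{..<k}. g j \<omega> \<le> c)}" for k
  have gm: "g j \<in> borel_measurable (G k)" if "j \<le> k" "k \<le> N" for j k
  proof -
    have "subalgebra (G k) (G j)"
      using sub[OF that(2)] sub[of j] order_trans[OF that] mono[OF that] by (simp add: subalgebra_def)
    then show ?thesis unfolding g_def by (rule measurable_from_subalg) simp
  qed
  have AG: "A k \<in> sets (G k)" if "k \<le> N" for k
  proof -
    have [measurable]: "g j \<in> borel_measurable (G k)" if "j \<le> k" for j using gm that \<open>k \<le> N\<close> by auto
    have "{\<omega> \<in> space (G k). g k \<omega> > c \<and> (\<forall>j\<in>{..<k}. g j \<omega> \<le> c)} \<in> sets (G k)"
      by measurable
    moreover have "space (G k) = space M" using sub[OF that] by (simp add: subalgebra_def)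
    ultimately show ?thesis by (simp add: A_def)
  qed
  have AM: "A k \<in> sets M" if "k \<le> N" for k
    using AG[OF that] sub[OF that] by (auto simp: subalgebra_def)
  have disj: "disjoint_family_on A {..N}"
    unfolding disjoint_family_on_def
  proof (intro ballI impI)
    fix j k :: nat assume "j \<noteq> k"
    moreover have "A j \<inter> A k = {}" if "j < k" for j k using that by (force simp: A_def)
    ultimately show "A j \<inter> A k = {}" by (metis Int_commute linorder_neqE_nat)
  qed
  have un: "{\<omega> \<in> space M. \<exists>k\<le>N. g k \<omega> > c} = (\<Union>k\<in>{..N}. A k)"
  proof (intro set_eqI iffI)
    fix \<omega> assume "\<omega> \<in> {\<omega> \<in> space M. \<exists>k\<le>N. g k \<omega> > c}"
    then have \<omega>: "\<omega> \<in> space M" "\<exists>k. k \<le> N \<and> g k \<omega> > c" by auto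
    define k where "k = (LEAST k. k \<le> N \<and> g k \<omega> > c)"
    have k: "k \<le> N \<and> g k \<omega> > c" unfolding k_def by (rule LeastI_ex[OF \<omega>(2)])
    have "\<not> (j \<le> N \<and> g j \<omega> > c)" if "j < k" for j using not_less_Least that unfolding k_def by blast
    then have "\<omega> \<in> A k" unfolding A_def using \<omega> k by (auto simp: not_less)
    then show "\<omega> \<in> (\<Union>k\<in>{..N}. A k)" using k by auto
  qed (auto simp: A_def)
  have ind: "integrable M (\<lambda>\<omega>. indicator (A k) \<omega> * f \<omega>)"
    if "k \<le> N" "integrable M f" for k and f :: "'a \<Rightarrow> real"
    using integrable_mult_indicator[OF AM[OF that(1)] that(2)] by simp
  have le: "c * prob (A k) \<le> (\<integral>\<omega>. indicator (A k) \<omega> * h \<omega> \<partial>M)" if "k \<le> N" for k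
  proof -
    interpret Gk: finite_measure_subalgebra M "G k"
      by (rule finite_measure_subalgebraI[OF sub[OF that]])
    have "c * prob (A k) = (\<integral>\<omega>. indicator (A k) \<omega> * c \<partial>M)"
      using AM[OF that] by (simp add: sets.Int_space_eq2)
    also have "\<dots> \<le> (\<integral>\<omega>. indicator (A k) \<omega> * g k \<omega> \<partial>M)"
    proof (rule integral_mono)
      show "integrable M (\<lambda>\<omega>. indicator (A k) \<omega> * c)" by (intro ind that) simp
      show "integrable M (\<lambda>\<omega>. indicator (A k) \<omega> * g k \<omega>)"
        unfolding g_def by (intro ind that Gk.real_cond_exp_int(1) h(1))
      show "indicator (A k) \<omega> * c \<le> indicator (A k) \<omega> * g k \<omega>" for \<omega>
        by (auto simp: A_def indicator_def)
    qed
    also have "\<dots> = (\<integral>\<omega>. indicator (A k) \<omega> * h \<omega> \<partial>M)"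
      unfolding g_def
      by (rule Gk.real_cond_exp_intg(2)) (use AG[OF that] h ind[OF that h(1)] in auto)
    finally show ?thesis .
  qed
  have "c * prob {\<omega> \<in> space M. \<exists>k\<le>N. g k \<omega> > c} = (\<Sum>k\<le>N. c * prob (A k))"
    unfolding un using AM disj
    by (subst finite_measure_finite_Union) (auto simp: sum_distrib_left)
  also have "\<dots> \<le> (\<Sum>k\<le>N. \<integral>\<omega>. indicator (A k) \<omega> * h \<omega> \<partial>M)"
    by (intro sum_mono le) auto
  also have "\<dots> = (\<integral>\<omega>. (\<Sum>k\<le>N. indicator (A k) \<omega> * h \<omega>) \<partial>M)"
    by (subst Bochner_Integration.integral_sum) (auto intro: ind h)
  also have "\<dots> \<le> (\<integral>\<omega>. h \<omega> \<partial>M)"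
  proof (rule integral_mono[OF Bochner_Integration.integrable_sum h(1)])
    fix \<omega>
    have "(\<Sum>k\<le>N. indicator (A k) \<omega> :: real) = indicator (\<Union>k\<in>{..N}. A k) \<omega>"
      using disj by (intro indicator_UN_disjoint[symmetric]) (auto simp: disjoint_family_on_def)
    also have "\<dots> \<le> 1" by (simp add: indicator_def)
    finally show "(\<Sum>k\<le>N. indicator (A k) \<omega> * h \<omega>) \<le> h \<omega>"
      using h(2)[of \<omega>] by (simp add: sum_distrib_right[symmetric] mult_left_le_one_le sum_nonneg)
  qed (auto intro: ind h)
  finally show ?thesis unfolding g_def .
qed

end

text \<open>One locale covers both directions, since they differ only in which end of a window has
  the largest sigma-algebra and in how the limit is identified.\<close>

locale monotone_subalgebras = prob_space M for M :: "'w measure" +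
  fixes F :: "nat \<Rightarrow> 'w measure"
  assumes sub: "\<And>n. subalgebra M (F n)"
    and mono: "incseq (\<lambda>n. sets (F n)) \<or> decseq (\<lambda>n. sets (F n))"
begin

sublocale F: finite_measure_subalgebra M "F n" for n
  by (rule finite_measure_subalgebraI[OF sub])

abbreviation E :: "('w \<Rightarrow> real) \<Rightarrow> nat \<Rightarrow> 'w \<Rightarrow> real" where
  "E f n \<equiv> real_cond_exp M (F n) f"

text \<open>A decreasing family becomes increasing on the window when read backwards as
  \<open>F (N - k)\<close>. The right-hand side does not involve the window, so \<open>N\<close> may
  later tend to infinity.\<close>

lemma doob_maximal_window:
  assumes h: "integrable M h" "\<And>\<omega>. h \<omega> \<ge> 0" and "c > 0"
  shows "c * prob {\<omega> \<in> space M. \<exists>k\<in>{m..N}. E h k \<omega> > c} \<le> (\<integral>\<omega>. h \<omega> \<partial>M)"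
proof (cases "m \<le> N")
  case True
  from mono show ?thesis
  proof
    assume inc: "incseq (\<lambda>n. sets (F n))"
    have "(\<exists>k\<in>{m..N}. E h k \<omega> > c) \<longleftrightarrow> (\<exists>k\<le>N - m. E h (m + k) \<omega> > c)" for \<omega>
    proof
      assume "\<exists>k\<in>{m..N}. E h k \<omega> > c"
      then obtain k where "k \<in> {m..N}" "E h k \<omega> > c" by blast
      then show "\<exists>k\<le>N - m. E h (m + k) \<omega> > c" by (intro exI[of _ "k - m"]) auto
    next
      assume "\<exists>k\<le>N - m. E h (m + k) \<omega> > c"
      then obtain k where "k \<le> N - m" "E h (m + k) \<omega> > c" by blast
      then show "\<exists>k\<in>{m..N}. E h k \<omega> > c" using True by (intro bexI[of _ "m + k"]) auto
    qed
    then show ?thesis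
      using doob_maximal_finite[of "N - m" "\<lambda>k. F (m + k)" h c] sub h \<open>c > 0\<close> inc by (simp add: incseq_def)
  next
    assume dec: "decseq (\<lambda>n. sets (F n))"
    have "(\<exists>k\<in>{m..N}. E h k \<omega> > c) \<longleftrightarrow> (\<exists>k\<le>N - m. E h (N - k) \<omega> > c)" for \<omega>
    proof
      assume "\<exists>k\<in>{m..N}. E h k \<omega> > c"
      then obtain k where "k \<in> {m..N}" "E h k \<omega> > c" by blast
      then show "\<exists>k\<le>N - m. E h (N - k) \<omega> > c" by (intro exI[of _ "N - k"]) auto
    next
      assume "\<exists>k\<le>N - m. E h (N - k) \<omega> > c"
      then obtain k where "k \<le> N - m" "E h (N - k) \<omega> > c" by blast
      then show "\<exists>k\<in>{m..N}. E h k \<omega> > c" using True by (intro bexI[of _ "N - k"]) auto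
    qed
    then show ?thesis
      using doob_maximal_finite[of "N - m" "\<lambda>k. F (N - k)" h c] sub h \<open>c > 0\<close> dec by (simp add: decseq_def)
  qed
qed (use h in simp)

text \<open>The window events increase with \<open>N\<close> to the tail event, so continuity from
  below preserves a uniform bound.\<close>

lemma prob_tail_le:
  fixes m :: nat
  assumes [measurable]: "\<And>k. Measurable.pred M (P k)"
    and le: "\<And>N. N \<ge> m \<Longrightarrow> prob {\<omega> \<in> space M. \<exists>k\<in>{m..N}. P k \<omega>} \<le> a"
  shows "prob {\<omega> \<in> space M. \<exists>k\<ge>m. P k \<omega>} \<le> a"
proof -
  let ?A = "\<lambda>N. {\<omega> \<in> space M. \<exists>k\<in>{m..N}. P k \<omega>}"
  have "(\<lambda>N. prob (?A N)) \<longlonglongrightarrow> prob (\<Union>N. ?A N)"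
  proof (rule finite_Lim_measure_incseq)
    show "incseq ?A" by (rule incseq_SucI) auto
  qed auto
  moreover have "(\<Union>N. ?A N) = {\<omega> \<in> space M. \<exists>k\<ge>m. P k \<omega>}" by force
  ultimately show ?thesis using le by (auto intro!: LIMSEQ_le_const2)
qed

lemma doob_maximal:
  assumes h: "integrable M h" "\<And>\<omega>. h \<omega> \<ge> 0" and "c > 0"
  shows "c * prob {\<omega> \<in> space M. \<exists>k. E h k \<omega> > c} \<le> (\<integral>\<omega>. h \<omega> \<partial>M)"
proof -
  have "prob {\<omega> \<in> space M. \<exists>k\<ge>0. E h k \<omega> > c} \<le> (\<integral>\<omega>. h \<omega> \<partial>M) / c"
  proof (rule prob_tail_le)
    show "prob {\<omega> \<in> space M. \<exists>k\<in>{0..N}. c < E h k \<omega>} \<le> (\<integral>\<omega>. h \<omega> \<partial>M) / c" for N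
      using doob_maximal_window[OF h \<open>c > 0\<close>, of 0 N] \<open>c > 0\<close> by (simp add: field_simps)
  qed measurable
  then show ?thesis using \<open>c > 0\<close> by (simp add: field_simps)
qed

end

section \<open>Tower property and the limit sigma-algebras\<close>

context monotone_subalgebras
begin

lemma subalgebra_le:
  assumes "sets (F j) \<subseteq> sets (F k)"
  shows "subalgebra (F k) (F j)"
  using sub[of j] sub[of k] assms by (simp add: subalgebra_def)

lemma E_nested:
  assumes "integrable M f" "sets (F j) \<subseteq> sets (F k)"
  shows "AE \<omega> in M. E (E f k) j \<omega> = E f j \<omega>"
  by (rule F.real_cond_exp_nested_subalg[OF sub subalgebra_le[OF assms(2)] assms(1)])

lemma E_absorb:
  assumes "integrable M f" "sets (F j) \<subseteq> sets (F k)"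
  shows "AE \<omega> in M. E (E f j) k \<omega> = E f j \<omega>"
proof (rule F.real_cond_exp_F_meas)
  show "integrable M (E f j)" by (rule F.real_cond_exp_int(1)[OF assms(1)])
  show "E f j \<in> borel_measurable (F k)"
    by (rule measurable_from_subalg[OF subalgebra_le[OF assms(2)]]) simp
qed

lemma E_abs_diff_le:
  assumes f: "integrable M f" and g: "integrable M g"
  shows "AE \<omega> in M. \<bar>E f k \<omega> - E g k \<omega>\<bar> \<le> E (\<lambda>\<omega>. \<bar>f \<omega> - g \<omega>\<bar>) k \<omega>"
proof -
  have i: "integrable M (\<lambda>\<omega>. f \<omega> - g \<omega>)" "integrable M (\<lambda>\<omega>. g \<omega> - f \<omega>)"
    "integrable M (\<lambda>\<omega>. \<bar>f \<omega> - g \<omega>\<bar>)" using f g by auto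
  have "AE \<omega> in M. E (\<lambda>\<omega>. f \<omega> - g \<omega>) k \<omega> \<le> E (\<lambda>\<omega>. \<bar>f \<omega> - g \<omega>\<bar>) k \<omega>"
    by (rule F.real_cond_exp_mono) (use i in auto)
  moreover have "AE \<omega> in M. E (\<lambda>\<omega>. g \<omega> - f \<omega>) k \<omega> \<le> E (\<lambda>\<omega>. \<bar>f \<omega> - g \<omega>\<bar>) k \<omega>"
    by (rule F.real_cond_exp_mono) (use i in auto)
  moreover note F.real_cond_exp_diff[OF f g, of k] F.real_cond_exp_diff[OF g f, of k]
  ultimately show ?thesis by eventually_elim auto
qed

lemma subalgebra_Union: "subalgebra M (sigma (space M) (\<Union>n. sets (F n)))"
proof -
  have "(\<Union>n. sets (F n)) \<subseteq> sets M" using sub by (auto simp: subalgebra_def)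
  then show ?thesis
    using sets.space_closed[of M] by (auto simp: subalgebra_def intro: sets.sigma_sets_subset[THEN subsetD])
qed

lemma sets_sigma_Inter: "sets (sigma (space M) (\<Inter>n. sets (F n))) \<subseteq> sets (F n)"
proof -
  have sp: "space (F n) = space M" for n using sub by (simp add: subalgebra_def)
  have "(\<Inter>n. sets (F n)) \<subseteq> Pow (space M)" using sets.space_closed[of "F 0"] sp by fastforce
  then show ?thesis using sets.sigma_sets_subset[of "\<Inter>n. sets (F n)" "F n"] sp by auto
qed

lemma subalgebra_Inter: "subalgebra M (sigma (space M) (\<Inter>n. sets (F n)))"
  using sets_sigma_Inter[of 0] sub[of 0] unfolding subalgebra_def by (auto simp: space_measure_of_conv)

section \<open>Levy's theorems for bounded functions\<close>

context
  fixes f :: "'w \<Rightarrow> real" and B :: real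
  assumes f_meas [measurable]: "f \<in> borel_measurable M" and f_bound: "\<And>\<omega>. \<bar>f \<omega>\<bar> \<le> B"
begin

lemma integrable_bounded_f: "integrable M f"
  by (rule integrable_const_bound[of _ B]) (use f_bound in auto)

lemma E_bound: "AE \<omega> in M. \<bar>E f k \<omega>\<bar> \<le> B"
proof -
  have "AE \<omega> in M. E f k \<omega> \<le> B"
    by (rule F.real_cond_exp_le_c[OF integrable_bounded_f]) (use f_bound abs_le_iff in blast)
  moreover have "AE \<omega> in M. E f k \<omega> \<ge> - B"
    by (rule F.real_cond_exp_ge_c[OF integrable_bounded_f])
      (use f_bound in \<open>auto simp: abs_le_iff minus_le_iff\<close>)
  ultimately show ?thesis by eventually_elim auto
qed

lemma integrable_E_mult: "integrable M (\<lambda>\<omega>. E f j \<omega> * E f k \<omega>)"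
proof (rule integrable_const_bound[of _ "B * B"])
  show "AE \<omega> in M. norm (E f j \<omega> * E f k \<omega>) \<le> B * B"
    using E_bound[of j] E_bound[of k]
    by eventually_elim (simp add: abs_mult mult_mono)
qed measurable

text \<open>\<open>E f j\<close> is also the conditional expectation of \<open>E f k\<close>, so the
  increment is orthogonal to \<open>E f j\<close>: the mixed integral equals that of the square of
  \<open>E f j\<close>.\<close>

lemma pythagoras:
  assumes "sets (F j) \<subseteq> sets (F k)"
  shows "(\<integral>\<omega>. (E f k \<omega> - E f j \<omega>)\<^sup>2 \<partial>M) = (\<integral>\<omega>. (E f k \<omega>)\<^sup>2 \<partial>M) - (\<integral>\<omega>. (E f j \<omega>)\<^sup>2 \<partial>M)"
proof -
  have "(\<integral>\<omega>. E f j \<omega> * E f k \<omega> \<partial>M) = (\<integral>\<omega>. E f j \<omega> * E (E f k) j \<omega> \<partial>M)"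
    by (rule F.real_cond_exp_intg(2)[symmetric]) (auto intro: integrable_E_mult)
  also have "\<dots> = (\<integral>\<omega>. E f j \<omega> * E f j \<omega> \<partial>M)"
    using E_nested[OF integrable_bounded_f assms] by (intro integral_cong_AE) auto
  finally have "(\<integral>\<omega>. E f j \<omega> * E f k \<omega> \<partial>M) = (\<integral>\<omega>. E f j \<omega> * E f j \<omega> \<partial>M)" .
  moreover have "(\<integral>\<omega>. (E f k \<omega> - E f j \<omega>)\<^sup>2 \<partial>M)
      = (\<integral>\<omega>. E f k \<omega> * E f k \<omega> - 2 * (E f j \<omega> * E f k \<omega>) + E f j \<omega> * E f j \<omega> \<partial>M)"
    by (intro Bochner_Integration.integral_cong) (auto simp: power2_eq_square algebra_simps)
  ultimately show ?thesis
    using integrable_E_mult by (simp add: power2_eq_square)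
qed

lemma E_Cauchy_L1:
  assumes "\<eta> > 0"
  shows "\<exists>m. \<forall>k\<ge>m. (\<integral>\<omega>. \<bar>E f k \<omega> - E f m \<omega>\<bar> \<partial>M) \<le> \<eta>"
proof -
  define s where "s k = (\<integral>\<omega>. (E f k \<omega>)\<^sup>2 \<partial>M)" for k
  have int2: "integrable M (\<lambda>\<omega>. (E f k \<omega> - E f j \<omega>)\<^sup>2)" for j k
    unfolding power2_diff mult.assoc using integrable_E_mult by (auto simp: power2_eq_square)
  have le: "s j \<le> s k" if "sets (F j) \<subseteq> sets (F k)" for j k
  proof -
    have "0 \<le> (\<integral>\<omega>. (E f k \<omega> - E f j \<omega>)\<^sup>2 \<partial>M)" by (rule Bochner_Integration.integral_nonneg) simp
    then show ?thesis using pythagoras[OF that] unfolding s_def by simp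
  qed
  have s_bound: "s k \<in> {0..B * B}" for k
  proof -
    have "s k \<le> (\<integral>\<omega>. B * B \<partial>M)"
      unfolding s_def using E_bound[of k] integrable_E_mult[of k k]
      by (intro integral_mono_AE) (auto simp: power2_eq_square intro!: abs_le_square_iff[THEN iffD1, unfolded power2_eq_square])
    then show ?thesis by (simp add: s_def prob_space)
  qed
  have "convergent s"
    using mono
  proof
    assume "incseq (\<lambda>n. sets (F n))"
    then have "incseq s" by (intro monoI le) (simp add: incseq_def)
    then show ?thesis
      by (rule incseq_convergent[of s "B * B"]) (use s_bound in \<open>auto intro: convergentI\<close>)
  next
    assume "decseq (\<lambda>n. sets (F n))"
    then have "decseq s" by (intro antimonoI le) (simp add: decseq_def)
    then show ?thesis
      by (rule decseq_convergent[of s 0]) (use s_bound in \<open>auto intro: convergentI\<close>)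
  qed
  then have "Cauchy s" by (rule convergent_Cauchy)
  then obtain m where m: "\<And>k. k \<ge> m \<Longrightarrow> \<bar>s k - s m\<bar> < \<eta>\<^sup>2 / 4"
    using CauchyD[of s "\<eta>\<^sup>2 / 4"] assms by (metis real_norm_def le_refl zero_less_power zero_less_divide_iff zero_less_numeral)
  show ?thesis
  proof (intro exI allI impI)
    fix k assume "k \<ge> m"
    have "(\<integral>\<omega>. (E f k \<omega> - E f m \<omega>)\<^sup>2 \<partial>M) = \<bar>s k - s m\<bar>"
      using mono
    proof
      assume "incseq (\<lambda>n. sets (F n))"
      then have "sets (F m) \<subseteq> sets (F k)" using \<open>k \<ge> m\<close> by (simp add: incseq_def)
      then show ?thesis using pythagoras[of m k] le[of m k] unfolding s_def by simp
    next
      assume "decseq (\<lambda>n. sets (F n))"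
      then have "sets (F k) \<subseteq> sets (F m)" using \<open>k \<ge> m\<close> by (simp add: decseq_def)
      then show ?thesis using pythagoras[of k m] le[of k m] unfolding s_def by (simp add: power2_commute)
    qed
    then have sq: "(\<integral>\<omega>. (E f k \<omega> - E f m \<omega>)\<^sup>2 \<partial>M) \<le> \<eta>\<^sup>2 / 4" using m[OF \<open>k \<ge> m\<close>] by simp
    \<comment> \<open>A pointwise arithmetic-geometric mean inequality passes from L2 to L1 in place
      of Cauchy-Schwarz.\<close>
    have "\<bar>x\<bar> \<le> \<eta> / 2 + x\<^sup>2 / (2 * \<eta>)" for x
    proof -
      have "0 \<le> (\<bar>x\<bar> - \<eta>)\<^sup>2" by simp
      then have "2 * \<eta> * \<bar>x\<bar> \<le> \<eta>\<^sup>2 + x\<^sup>2" by (simp add: power2_diff ac_simps)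
      then show ?thesis using assms by (simp add: field_simps power2_eq_square)
    qed
    then have "(\<integral>\<omega>. \<bar>E f k \<omega> - E f m \<omega>\<bar> \<partial>M) \<le> (\<integral>\<omega>. \<eta> / 2 + (E f k \<omega> - E f m \<omega>)\<^sup>2 / (2 * \<eta>) \<partial>M)"
      using int2 F.real_cond_exp_int(1)[OF integrable_bounded_f] by (intro integral_mono) auto
    also have "\<dots> = \<eta> / 2 + (\<integral>\<omega>. (E f k \<omega> - E f m \<omega>)\<^sup>2 \<partial>M) / (2 * \<eta>)"
      using int2 by (subst Bochner_Integration.integral_add) (auto simp: prob_space)
    also have "\<dots> \<le> \<eta> / 2 + (\<eta>\<^sup>2 / 4) / (2 * \<eta>)"
      using sq assms by (intro add_mono divide_right_mono) auto
    also have "\<dots> \<le> \<eta>" using assms by (simp add: power2_eq_square field_simps)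
    finally show "(\<integral>\<omega>. \<bar>E f k \<omega> - E f m \<omega>\<bar> \<partial>M) \<le> \<eta>" .
  qed
qed

text \<open>On a window \<open>{m..N}\<close> an increasing family makes \<open>E f k - E f m\<close>, and a decreasing family
  \<open>E f k - E f N\<close>, the conditional expectation of the total increment.\<close>

lemma prob_window_le:
  assumes "c > 0" "m \<le> N"
  shows "c * prob {\<omega> \<in> space M. \<exists>k\<in>{m..N}. \<bar>E f k \<omega> - E f m \<omega>\<bar> > 2 * c} \<le> (\<integral>\<omega>. \<bar>E f N \<omega> - E f m \<omega>\<bar> \<partial>M)"
proof -
  let ?h = "\<lambda>\<omega>. \<bar>E f N \<omega> - E f m \<omega>\<bar>"
  note intE = F.real_cond_exp_int(1)[OF integrable_bounded_f]
  have "AE \<omega> in M. \<forall>k\<in>{m..N}. \<bar>E f k \<omega> - E f m \<omega>\<bar> > 2 * c \<longrightarrow> (\<exists>k\<in>{m..N}. E ?h k \<omega> > c)"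
    using mono
  proof
    assume inc: "incseq (\<lambda>n. sets (F n))"
    have "AE \<omega> in M. \<bar>E f k \<omega> - E f m \<omega>\<bar> \<le> E ?h k \<omega>" if "k \<in> {m..N}" for k
    proof -
      have "AE \<omega> in M. E (E f N) k \<omega> = E f k \<omega>"
        using inc that by (intro E_nested integrable_bounded_f) (auto simp: incseq_def)
      moreover have "AE \<omega> in M. E (E f m) k \<omega> = E f m \<omega>"
        using inc that by (intro E_absorb integrable_bounded_f) (auto simp: incseq_def)
      moreover note E_abs_diff_le[OF intE[of N] intE[of m], of k]
      ultimately show ?thesis by eventually_elim auto
    qed
    then have "AE \<omega> in M. \<forall>k\<in>{m..N}. \<bar>E f k \<omega> - E f m \<omega>\<bar> \<le> E ?h k \<omega>"
      by (intro AE_finite_allI) auto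
    then show ?thesis by eventually_elim (use \<open>c > 0\<close> in force)
  next
    assume dec: "decseq (\<lambda>n. sets (F n))"
    have "AE \<omega> in M. \<bar>E f N \<omega> - E f k \<omega>\<bar> \<le> E ?h k \<omega>" if "k \<in> {m..N}" for k
    proof -
      have "AE \<omega> in M. E (E f m) k \<omega> = E f k \<omega>"
        using dec that by (intro E_nested integrable_bounded_f) (auto simp: decseq_def)
      moreover have "AE \<omega> in M. E (E f N) k \<omega> = E f N \<omega>"
        using dec that by (intro E_absorb integrable_bounded_f) (auto simp: decseq_def)
      moreover note E_abs_diff_le[OF intE[of N] intE[of m], of k]
      ultimately show ?thesis by eventually_elim auto
    qed
    then have "AE \<omega> in M. \<forall>k\<in>{m..N}. \<bar>E f N \<omega> - E f k \<omega>\<bar> \<le> E ?h k \<omega>"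
      by (intro AE_finite_allI) auto
    then show ?thesis
    proof eventually_elim
      case (elim \<omega>)
      show ?case
      proof (intro ballI impI)
        fix k assume k: "k \<in> {m..N}" "\<bar>E f k \<omega> - E f m \<omega>\<bar> > 2 * c"
        \<comment> \<open>Here the reference point is \<open>N\<close>, not \<open>m\<close>. The
          triangle inequality through \<open>E f N\<close> explains the threshold
          \<open>2 * c\<close>, and its second alternative is the bound at index \<open>m\<close> of
          the window.\<close>
        then have "\<bar>E f N \<omega> - E f k \<omega>\<bar> > c \<or> \<bar>E f N \<omega> - E f m \<omega>\<bar> > c" by linarith
        moreover have "m \<in> {m..N}" using \<open>m \<le> N\<close> by simp
        ultimately show "\<exists>k\<in>{m..N}. E ?h k \<omega> > c" using elim k(1) by (meson less_le_trans)
      qed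
    qed
  qed
  then have "prob {\<omega> \<in> space M. \<exists>k\<in>{m..N}. \<bar>E f k \<omega> - E f m \<omega>\<bar> > 2 * c}
      \<le> prob {\<omega> \<in> space M. \<exists>k\<in>{m..N}. E ?h k \<omega> > c}"
    by (intro finite_measure_mono_AE) auto
  then have "c * prob {\<omega> \<in> space M. \<exists>k\<in>{m..N}. \<bar>E f k \<omega> - E f m \<omega>\<bar> > 2 * c}
      \<le> c * prob {\<omega> \<in> space M. \<exists>k\<in>{m..N}. E ?h k \<omega> > c}"
    using \<open>c > 0\<close> by simp
  also have "\<dots> \<le> (\<integral>\<omega>. ?h \<omega> \<partial>M)"
    by (rule doob_maximal_window) (use intE \<open>c > 0\<close> in auto)
  finally show ?thesis .
qed

text \<open>The exceptional event lies in the tail event of every \<open>m\<close>. Choosing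
  \<open>m\<close> by the L1 Cauchy property with tolerance \<open>c * e\<close> makes that tail
  event at most \<open>e\<close> in probability, because the maximal inequality loses a factor
  \<open>1 / c\<close>.\<close>

lemma AE_eventually_close:
  assumes "c > 0"
  shows "AE \<omega> in M. \<exists>m. \<forall>k\<ge>m. \<bar>E f k \<omega> - E f m \<omega>\<bar> \<le> 2 * c"
proof -
  let ?A = "{\<omega> \<in> space M. \<forall>m. \<exists>k\<ge>m. \<bar>E f k \<omega> - E f m \<omega>\<bar> > 2 * c}"
  have [measurable]: "?A \<in> sets M" by measurable
  have "prob ?A \<le> e" if "e > 0" for e
  proof -
    obtain m where m: "\<And>k. k \<ge> m \<Longrightarrow> (\<integral>\<omega>. \<bar>E f k \<omega> - E f m \<omega>\<bar> \<partial>M) \<le> c * e"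
      using E_Cauchy_L1[of "c * e"] assms \<open>e > 0\<close> by auto
    have "prob ?A \<le> prob {\<omega> \<in> space M. \<exists>k\<ge>m. \<bar>E f k \<omega> - E f m \<omega>\<bar> > 2 * c}"
      by (intro finite_measure_mono) auto
    also have "\<dots> \<le> e"
    proof (rule prob_tail_le)
      fix N assume "N \<ge> m"
      have "c * prob {\<omega> \<in> space M. \<exists>k\<in>{m..N}. \<bar>E f k \<omega> - E f m \<omega>\<bar> > 2 * c} \<le> c * e"
        using prob_window_le[OF assms \<open>N \<ge> m\<close>] m[OF \<open>N \<ge> m\<close>] by (rule order_trans)
      then show "prob {\<omega> \<in> space M. \<exists>k\<in>{m..N}. \<bar>E f k \<omega> - E f m \<omega>\<bar> > 2 * c} \<le> e"
        using assms by simp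
    qed measurable
    finally show ?thesis .
  qed
  then have "prob ?A \<le> 0" by (rule field_le_epsilon) simp
  then have "prob ?A = 0" by (simp add: measure_le_0_iff)
  then have "AE \<omega> in M. \<omega> \<notin> ?A" by (subst (asm) prob_eq_0) auto
  with AE_space[of M] show ?thesis by eventually_elim (simp add: not_less)
qed

lemma AE_convergent: "AE \<omega> in M. convergent (\<lambda>k. E f k \<omega>)"
proof -
  have "AE \<omega> in M. \<forall>i::nat. \<exists>m. \<forall>k\<ge>m. \<bar>E f k \<omega> - E f m \<omega>\<bar> \<le> 2 * (1 / real (Suc i))"
    unfolding AE_all_countable by (intro allI AE_eventually_close) simp
  then show ?thesis
  proof eventually_elim
    case (elim \<omega>)
    have "Cauchy (\<lambda>k. E f k \<omega>)"
    proof (rule metric_CauchyI)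
      fix e :: real assume "e > 0"
      then obtain i where i: "inverse (real (Suc i)) < e / 4"
        using reals_Archimedean[of "e / 4"] by auto
      obtain m where m: "\<And>k. k \<ge> m \<Longrightarrow> \<bar>E f k \<omega> - E f m \<omega>\<bar> \<le> 2 * (1 / real (Suc i))"
        using elim by blast
      have "dist (E f k \<omega>) (E f l \<omega>) < e" if "k \<ge> m" "l \<ge> m" for k l
        using m[OF that(1)] m[OF that(2)] i unfolding dist_real_def inverse_eq_divide by linarith
      then show "\<exists>m. \<forall>k\<ge>m. \<forall>l\<ge>m. dist (E f k \<omega>) (E f l \<omega>) < e" by blast
    qed
    then show ?case by (simp add: Cauchy_convergent_iff)
  qed
qed

text \<open>The part of the identification common to both directions: the limit is bounded by
  \<open>B\<close>, and dominated convergence carries integrals over every event to the limit. Each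
  direction must still show that the limit is measurable for \<open>G\<close> and has the same
  integrals as \<open>f\<close> over the sets of \<open>G\<close>.\<close>

lemma AE_tendsto_cond_exp:
  assumes G: "subalgebra M G"
    and meas: "(\<lambda>\<omega>. lim (\<lambda>k. E f k \<omega>)) \<in> borel_measurable G"
    and int: "\<And>g A. integrable M g \<Longrightarrow> A \<in> sets G \<Longrightarrow>
      (\<And>A. A \<in> sets M \<Longrightarrow> (\<lambda>k. \<integral>\<omega>\<in>A. E f k \<omega> \<partial>M) \<longlonglongrightarrow> (\<integral>\<omega>\<in>A. g \<omega> \<partial>M)) \<Longrightarrow>
      (\<integral>\<omega>\<in>A. f \<omega> \<partial>M) = (\<integral>\<omega>\<in>A. g \<omega> \<partial>M)"
  shows "AE \<omega> in M. (\<lambda>k. E f k \<omega>) \<longlonglongrightarrow> real_cond_exp M G f \<omega>"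
proof -
  interpret G: finite_measure_subalgebra M G by (rule finite_measure_subalgebraI[OF G])
  define g where "g \<omega> = lim (\<lambda>k. E f k \<omega>)" for \<omega>
  have [measurable]: "g \<in> borel_measurable G" using meas by (simp add: g_def[abs_def])
  have [measurable]: "g \<in> borel_measurable M" by (rule measurable_from_subalg[OF G]) simp
  have lim: "AE \<omega> in M. (\<lambda>k. E f k \<omega>) \<longlonglongrightarrow> g \<omega>"
    using AE_convergent by eventually_elim (simp add: g_def convergent_LIMSEQ_iff)
  have bound: "AE \<omega> in M. \<forall>k. \<bar>E f k \<omega>\<bar> \<le> B" by (simp add: AE_all_countable E_bound)
  have "AE \<omega> in M. \<bar>g \<omega>\<bar> \<le> B"
    using lim bound by eventually_elim (auto intro: LIMSEQ_le_const2[OF tendsto_rabs])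
  then have ig: "integrable M g" by (intro integrable_const_bound[of _ B]) auto
  have "(\<lambda>k. \<integral>\<omega>\<in>A. E f k \<omega> \<partial>M) \<longlonglongrightarrow> (\<integral>\<omega>\<in>A. g \<omega> \<partial>M)" if [measurable]: "A \<in> sets M" for A
    unfolding set_lebesgue_integral_def
  proof (rule integral_dominated_convergence[where w = "\<lambda>_. B"])
    show "AE \<omega> in M. (\<lambda>k. indicator A \<omega> *\<^sub>R E f k \<omega>) \<longlonglongrightarrow> indicator A \<omega> *\<^sub>R g \<omega>"
      using lim by eventually_elim (intro tendsto_intros)
    show "AE \<omega> in M. norm (indicator A \<omega> *\<^sub>R E f k \<omega>) \<le> B" for k
      using E_bound[of k] by eventually_elim (auto simp: indicator_def)
  qed auto
  then have "AE \<omega> in M. real_cond_exp M G f \<omega> = g \<omega>"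
    using int[OF ig] by (intro G.real_cond_exp_charact integrable_bounded_f ig) auto
  with lim show ?thesis by eventually_elim simp
qed

text \<open>For a set of \<open>F m\<close> the integrals of \<open>E f k\<close> equal that of
  \<open>f\<close> as soon as \<open>k \<ge> m\<close>. The union of an increasing family is stable
  under intersection, so the identity extends to the generated sigma-algebra by Dynkin's
  theorem.\<close>

lemma levy_upward:
  assumes inc: "incseq (\<lambda>n. sets (F n))"
  shows "AE \<omega> in M. (\<lambda>k. E f k \<omega>) \<longlonglongrightarrow> real_cond_exp M (sigma (space M) (\<Union>n. sets (F n))) f \<omega>"
proof (rule AE_tendsto_cond_exp)
  let ?U = "\<Union>n. sets (F n)" and ?G = "sigma (space M) (\<Union>n. sets (F n))"
  have U: "?U \<subseteq> sets M" using sub by (auto simp: subalgebra_def)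
  have UP: "?U \<subseteq> Pow (space M)" using U sets.space_closed by blast
  have sG: "sets ?G = sigma_sets (space M) ?U" "space ?G = space M" using UP by auto
  show "subalgebra M ?G" by (rule subalgebra_Union)
  have "E f k \<in> borel_measurable ?G" for k
  proof (rule measurable_from_subalg)
    show "subalgebra ?G (F k)" using sub[of k] sG by (auto simp: subalgebra_def)
  qed simp
  then show "(\<lambda>\<omega>. lim (\<lambda>k. E f k \<omega>)) \<in> borel_measurable ?G" by (rule borel_measurable_lim_metric)
  fix g A assume ig: "integrable M g" and A: "A \<in> sets ?G"
    and lim: "\<And>A. A \<in> sets M \<Longrightarrow> (\<lambda>k. \<integral>\<omega>\<in>A. E f k \<omega> \<partial>M) \<longlonglongrightarrow> (\<integral>\<omega>\<in>A. g \<omega> \<partial>M)"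
  note if' = integrable_bounded_f
  have base: "(\<integral>\<omega>\<in>A. f \<omega> \<partial>M) = (\<integral>\<omega>\<in>A. g \<omega> \<partial>M)" if AU: "A \<in> ?U" for A
  proof -
    obtain m where m: "A \<in> sets (F m)" using AU by blast
    have "(\<integral>\<omega>\<in>A. E f k \<omega> \<partial>M) = (\<integral>\<omega>\<in>A. f \<omega> \<partial>M)" if "k \<ge> m" for k
      using m inc that by (intro F.real_cond_exp_intA[symmetric] if') (auto simp: incseq_def)
    then have "(\<lambda>k. \<integral>\<omega>\<in>A. E f k \<omega> \<partial>M) \<longlonglongrightarrow> (\<integral>\<omega>\<in>A. f \<omega> \<partial>M)"
      by (intro tendsto_eventually eventually_sequentiallyI[of m])
    then show ?thesis using lim[of A] AU U LIMSEQ_unique by blast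
  qed
  have "Int_stable ?U"
  proof (rule Int_stableI)
    fix a b assume "a \<in> ?U" "b \<in> ?U"
    then obtain i j where "a \<in> sets (F i)" "b \<in> sets (F j)" by blast
    then have "a \<in> sets (F (max i j))" "b \<in> sets (F (max i j))"
      using inc[THEN incseqD, of i "max i j"] inc[THEN incseqD, of j "max i j"] by auto
    then show "a \<inter> b \<in> ?U" by blast
  qed
  moreover note UP
  moreover have "A \<in> sigma_sets (space M) ?U" using A sG by simp
  ultimately show "(\<integral>\<omega>\<in>A. f \<omega> \<partial>M) = (\<integral>\<omega>\<in>A. g \<omega> \<partial>M)"
  proof (induction rule: sigma_sets_induct_disjoint)
    case (compl A)
    have A: "A \<in> sets M" using compl(1) U by (auto intro: sets.sigma_sets_subset[THEN subsetD])
    have top: "space M \<in> ?U"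
      using sets.top[of "F 0"] sub[of 0] unfolding subalgebra_def by (metis UN_iff UNIV_I)
    have "(\<integral>\<omega>\<in>space M - A. h \<omega> \<partial>M) = (\<integral>\<omega>\<in>space M. h \<omega> \<partial>M) - (\<integral>\<omega>\<in>A. h \<omega> \<partial>M)"
      if "integrable M h" for h :: "'w \<Rightarrow> real"
    proof -
      have s: "set_integrable M X h" if "X \<in> sets M" for X
        unfolding set_integrable_def using integrable_mult_indicator[OF that \<open>integrable M h\<close>] .
      have "(\<integral>\<omega>\<in>(space M - A) \<union> A. h \<omega> \<partial>M) = (\<integral>\<omega>\<in>space M - A. h \<omega> \<partial>M) + (\<integral>\<omega>\<in>A. h \<omega> \<partial>M)"
        using A by (intro set_integral_Un s) auto
      moreover have "(space M - A) \<union> A = space M" using sets.sets_into_space[OF A] by auto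
      ultimately show ?thesis by simp
    qed
    then show ?case using compl(2) base[OF top] ig if' by simp
  next
    case (union A)
    have A: "A i \<in> sets M" for i using union(2) U by (auto intro: sets.sigma_sets_subset[THEN subsetD])
    have "(\<integral>\<omega>\<in>(\<Union>i. A i). h \<omega> \<partial>M) = (\<Sum>i. \<integral>\<omega>\<in>A i. h \<omega> \<partial>M)"
      if "integrable M h" for h :: "'w \<Rightarrow> real"
    proof (rule lebesgue_integral_countable_add)
      show "set_integrable M (\<Union>i. A i) h"
        unfolding set_integrable_def using A by (intro integrable_mult_indicator[OF _ \<open>integrable M h\<close>]) auto
    qed (use A union(1) in \<open>auto simp: disjoint_family_on_def\<close>)
    then show ?case using union(3) ig if' by simp
  qed (use base in \<open>auto simp: set_lebesgue_integral_def\<close>)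
qed

text \<open>The limit depends only on the terms from index \<open>m\<close> on, all measurable for
  \<open>F m\<close>, so it is measurable for every \<open>F m\<close>. A set of the limit
  sigma-algebra lies in every \<open>F k\<close>, so its integrals are constant in
  \<open>k\<close>.\<close>

lemma levy_downward:
  assumes dec: "decseq (\<lambda>n. sets (F n))"
  shows "AE \<omega> in M. (\<lambda>k. E f k \<omega>) \<longlonglongrightarrow> real_cond_exp M (sigma (space M) (\<Inter>n. sets (F n))) f \<omega>"
proof (rule AE_tendsto_cond_exp)
  let ?I = "\<Inter>n. sets (F n)" and ?G = "sigma (space M) (\<Inter>n. sets (F n))"
  have sp: "space (F n) = space M" for n using sub by (simp add: subalgebra_def)
  have IP: "?I \<subseteq> Pow (space M)" using sets.space_closed[of "F 0"] sp by fastforce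
  have sG: "sets ?G = sigma_sets (space M) ?I" "space ?G = space M" using IP by auto
  note sG' = sets_sigma_Inter
  show "subalgebra M ?G" by (rule subalgebra_Inter)
  let ?g = "\<lambda>\<omega>. lim (\<lambda>k. E f k \<omega>)"
  have gF: "?g \<in> borel_measurable (F m)" for m
  proof -
    have "E f (k + m) \<in> borel_measurable (F m)" for k
      using dec by (intro measurable_from_subalg[OF subalgebra_le[of "k + m" m]]) (auto simp: decseq_def)
    then have "(\<lambda>\<omega>. lim (\<lambda>k. E f (k + m) \<omega>)) \<in> borel_measurable (F m)"
      by (rule borel_measurable_lim_metric)
    \<comment> \<open>Holds also where the sequence diverges: \<open>lim\<close> is a description,
      and both sequences have the same set of limits.\<close>
    moreover have "lim (\<lambda>k. E f (k + m) \<omega>) = ?g \<omega>" for \<omega>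
    proof -
      have "(\<lambda>k. E f (k + m) \<omega>) \<longlonglongrightarrow> L \<longleftrightarrow> (\<lambda>k. E f k \<omega>) \<longlonglongrightarrow> L" for L
        using LIMSEQ_ignore_initial_segment[of "\<lambda>k. E f k \<omega>" L m] LIMSEQ_offset[of "\<lambda>k. E f k \<omega>" m L]
        by blast
      then show ?thesis by (simp add: lim_def)
    qed
    ultimately show ?thesis by simp
  qed
  show "?g \<in> borel_measurable ?G"
  proof (rule measurableI)
    fix S :: "real set" assume "S \<in> sets borel"
    then have "?g -` S \<inter> space M \<in> sets (F m)" for m
      using measurable_sets[OF gF[of m]] sp by simp
    then show "?g -` S \<inter> space ?G \<in> sets ?G" unfolding sG by auto
  qed simp
  fix g A assume "integrable M g" and A: "A \<in> sets ?G"
    and lim: "\<And>A. A \<in> sets M \<Longrightarrow> (\<lambda>k. \<integral>\<omega>\<in>A. E f k \<omega> \<partial>M) \<longlonglongrightarrow> (\<integral>\<omega>\<in>A. g \<omega> \<partial>M)"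
  have "(\<integral>\<omega>\<in>A. E f k \<omega> \<partial>M) = (\<integral>\<omega>\<in>A. f \<omega> \<partial>M)" for k
    using A sG' by (intro F.real_cond_exp_intA[symmetric] integrable_bounded_f) auto
  moreover have "A \<in> sets M" using A sG'[of 0] sub[of 0] unfolding subalgebra_def by blast
  ultimately show "(\<integral>\<omega>\<in>A. f \<omega> \<partial>M) = (\<integral>\<omega>\<in>A. g \<omega> \<partial>M)"
    using lim[of A] by (simp add: LIMSEQ_const_iff)
qed

end
end

section \<open>Conditional expectations of random elements\<close>

lemma (in finite_measure_subalgebra) real_cond_exp_simple:
  assumes fin: "finite I" and A: "\<And>i. i \<in> I \<Longrightarrow> A i \<in> sets M" and f: "f \<in> borel_measurable M"
    and eq: "\<And>\<omega>. \<omega> \<in> space M \<Longrightarrow> f \<omega> = (\<Sum>i\<in>I. a i * indicator (A i) \<omega>)"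
  shows "AE \<omega> in M. real_cond_exp M F f \<omega> = (\<Sum>i\<in>I. a i * real_cond_exp M F (indicator (A i)) \<omega>)"
proof -
  \<comment> \<open>Empty sets outside \<open>I\<close> make every index measurable, so that
    linearity applies to a family without side conditions.\<close>
  define B where "B i = (if i \<in> I then A i else {})" for i
  have B [measurable]: "B i \<in> sets M" for i using A by (simp add: B_def)
  have int: "integrable M (indicator (B i) :: 'a \<Rightarrow> real)" for i
    by (rule integrable_real_indicator) (auto simp: emeasure_eq_measure)
  let ?g = "\<lambda>\<omega>. \<Sum>i\<in>I. a i * indicator (B i) \<omega>"
  have "AE \<omega> in M. real_cond_exp M F f \<omega> = real_cond_exp M F ?g \<omega>"
    by (rule real_cond_exp_cong) (use f A in \<open>auto simp: eq B_def intro!: sum.cong\<close>)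
  moreover have "AE \<omega> in M. real_cond_exp M F ?g \<omega> = (\<Sum>i\<in>I. real_cond_exp M F (\<lambda>\<omega>. a i * indicator (B i) \<omega>) \<omega>)"
    by (rule real_cond_exp_sum) (use int in simp)
  moreover have "AE \<omega> in M. \<forall>i\<in>I. real_cond_exp M F (\<lambda>\<omega>. a i * indicator (B i) \<omega>) \<omega>
      = a i * real_cond_exp M F (indicator (B i)) \<omega>"
    by (intro AE_finite_allI fin real_cond_exp_cmult int)
  ultimately show ?thesis
    by eventually_elim (auto simp: B_def intro!: sum.cong)
qed

text \<open>Trades the minimum for a bounded quantifier over distances, a form whose measurability
  is derived automatically.\<close>

lemma nearest_index_eq:
  "nearest_index u n x = (LEAST i. i \<le> n \<and> (\<forall>j\<in>{0..n}. dist (u i) x \<le> dist (u j) x))"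
proof -
  have "i \<le> n \<and> dist (u i) x = Min ((\<lambda>j. dist (u j) x) ` {0..n}) \<longleftrightarrow>
      i \<le> n \<and> (\<forall>j\<in>{0..n}. dist (u i) x \<le> dist (u j) x)" for i
    by (auto simp: eq_Min_iff)
  then show ?thesis unfolding nearest_index_def by simp
qed

lemma nearest_index_props:
  "nearest_index u n x \<le> n" "j \<le> n \<Longrightarrow> dist (nearest_point u n x) x \<le> dist (u j) x"
proof -
  have "Min ((\<lambda>j. dist (u j) x) ` {0..n}) \<in> (\<lambda>j. dist (u j) x) ` {0..n}" by (rule Min_in) auto
  then obtain i where "i \<le> n \<and> dist (u i) x = Min ((\<lambda>j. dist (u j) x) ` {0..n})" by force
  then have *: "nearest_index u n x \<le> n \<and>
      dist (u (nearest_index u n x)) x = Min ((\<lambda>j. dist (u j) x) ` {0..n})"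
    unfolding nearest_index_def by (rule LeastI)
  then show "nearest_index u n x \<le> n" by simp
  show "dist (nearest_point u n x) x \<le> dist (u j) x" if "j \<le> n"
    using * that unfolding nearest_point_def by simp
qed

lemma measurable_nearest_point [measurable]:
  fixes u :: "nat \<Rightarrow> 'a::polish_space"
  shows "nearest_point u n \<in> borel_measurable borel"
proof -
  have "nearest_index u n \<in> borel \<rightarrow>\<^sub>M count_space UNIV"
    unfolding nearest_index_eq[abs_def] by measurable
  then show ?thesis unfolding nearest_point_def[abs_def] by measurable
qed

lemma nearest_point_tendsto:
  fixes u :: "nat \<Rightarrow> 'a::metric_space"
  assumes "closure (u ` {1..}) = UNIV"
  shows "(\<lambda>n. dist (nearest_point u n x) x) \<longlonglongrightarrow> 0"
proof (rule LIMSEQ_I)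
  fix r :: real assume "r > 0"
  have "x \<in> closure (u ` {1..})" using assms by simp
  then obtain j where "dist (u j) x < r" using \<open>r > 0\<close> by (force simp: closure_approachable)
  then have "norm (dist (nearest_point u n x) x - 0) < r" if "n \<ge> j" for n
    using nearest_index_props(2)[OF that, of u x] by simp
  then show "\<exists>no. \<forall>n\<ge>no. norm (dist (nearest_point u n x) x - 0) < r" by blast
qed

lemma nearest_point_dist_antimono:
  "m \<le> n \<Longrightarrow> dist (nearest_point u n x) x \<le> dist (nearest_point u m x) x"
  unfolding nearest_point_def[of u m]
  by (rule nearest_index_props(2)) (use nearest_index_props(1)[of u m x] in simp)

text \<open>Extends the power by 0 to the negative half-line, so that Jensen's inequality can be
  used on all of the reals although the function may vanish. If \<open>x \<le> 0\<close>, convexity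
  reduces to \<open>t powr p \<le> t\<close>.\<close>

lemma convex_on_pos_part_powr:
  assumes "p \<ge> (1::real)"
  shows "convex_on UNIV (\<lambda>x. (max 0 x) powr p)"
proof (rule convex_on_linorderI)
  fix t x y :: real assume t: "t > 0" "t < 1" and "x < y"
  show "(max 0 ((1 - t) *\<^sub>R x + t *\<^sub>R y)) powr p \<le> (1 - t) * (max 0 x) powr p + t * (max 0 y) powr p"
  proof (cases "x > 0")
    case True
    then have "((1 - t) *\<^sub>R x + t *\<^sub>R y) powr p \<le> (1 - t) * x powr p + t * y powr p"
      using convex_onD[OF powr_convex[OF assms], of t x y] t \<open>x < y\<close> by auto
    moreover have "(1 - t) *\<^sub>R x + t *\<^sub>R y \<ge> 0" using True t \<open>x < y\<close> by simp
    ultimately show ?thesis using True \<open>x < y\<close> by simp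
  next
    case False
    have "(1 - t) * x \<le> 0" using False t by (simp add: mult_nonneg_nonpos)
    moreover have "t * y \<le> t * max 0 y" "0 \<le> t * max 0 y" using t by auto
    ultimately have "max 0 ((1 - t) *\<^sub>R x + t *\<^sub>R y) \<le> t * max 0 y" by simp
    then have "(max 0 ((1 - t) *\<^sub>R x + t *\<^sub>R y)) powr p \<le> (t * max 0 y) powr p"
      using assms by (intro powr_mono2) auto
    also have "\<dots> = t powr p * (max 0 y) powr p" by (rule powr_mult)
    also have "\<dots> \<le> t * (max 0 y) powr p"
      using t assms powr_mono'[of 1 p t] by (intro mult_right_mono) auto
    finally show ?thesis using False by simp
  qed
qed simp

lemma (in finite_measure_subalgebra) real_cond_exp_powr_le:
  assumes "p \<ge> (1::real)" "integrable M h" "\<And>\<omega>. h \<omega> \<ge> 0" "integrable M (\<lambda>\<omega>. h \<omega> powr p)"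
  shows "integrable M (\<lambda>\<omega>. real_cond_exp M F h \<omega> powr p)"
    and "(\<integral>\<omega>. real_cond_exp M F h \<omega> powr p \<partial>M) \<le> (\<integral>\<omega>. h \<omega> powr p \<partial>M)"
proof -
  let ?q = "\<lambda>x::real. (max 0 x) powr p"
  have qh: "?q (h \<omega>) = h \<omega> powr p" for \<omega> using assms(3)[of \<omega>] by simp
  have pos: "AE \<omega> in M. real_cond_exp M F h \<omega> \<ge> 0"
    by (rule real_cond_exp_pos) (use assms in auto)
  have "AE \<omega> in M. ?q (real_cond_exp M F h \<omega>) \<le> real_cond_exp M F (\<lambda>\<omega>. ?q (h \<omega>)) \<omega>"
    by (rule real_cond_exp_jensens_inequality(2)[of h UNIV])
      (use assms convex_on_pos_part_powr qh in auto)
  with pos have le: "AE \<omega> in M. real_cond_exp M F h \<omega> powr p \<le> real_cond_exp M F (\<lambda>\<omega>. h \<omega> powr p) \<omega>"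
    unfolding qh by eventually_elim simp
  note i = real_cond_exp_int[OF assms(4)]
  show *: "integrable M (\<lambda>\<omega>. real_cond_exp M F h \<omega> powr p)"
    by (rule Bochner_Integration.integrable_bound[OF i(1)]) (use le in auto)
  show "(\<integral>\<omega>. real_cond_exp M F h \<omega> powr p \<partial>M) \<le> (\<integral>\<omega>. h \<omega> powr p \<partial>M)"
    using integral_mono_AE[OF * i(1) le] i(2) by simp
qed

lemma integrable_nonneg_bound:
  fixes f g :: "'a \<Rightarrow> real"
  assumes "integrable M g" "f \<in> borel_measurable M" "\<And>\<omega>. 0 \<le> f \<omega>" "AE \<omega> in M. f \<omega> \<le> g \<omega>"
  shows "integrable M f"
  by (rule Bochner_Integration.integrable_bound[OF assms(1,2)]) (use assms(3,4) in auto)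

text \<open>The sum is at most three times the largest term. The constant is crude but independent
  of the terms.\<close>

lemma powr_add3_le:
  assumes "a \<ge> 0" "b \<ge> 0" "c \<ge> 0" "p \<ge> (0::real)"
  shows "(a + b + c) powr p \<le> 3 powr p * (a powr p + b powr p + c powr p)"
proof -
  let ?m = "max a (max b c)"
  have "(a + b + c) powr p \<le> (3 * ?m) powr p" using assms by (intro powr_mono2) auto
  also have "\<dots> = 3 powr p * ?m powr p" by (rule powr_mult)
  also have "?m powr p \<le> a powr p + b powr p + c powr p"
    by (cases "?m = a"; cases "?m = b"; cases "?m = c") (auto simp: max_def split: if_splits)
  finally show ?thesis by simp
qed

text \<open>Being Cauchy is a measurable condition and, by completeness, equivalent to convergence.
  Replacing the sequence by the constant \<open>c\<close> elsewhere gives functions that converge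
  everywhere.\<close>

lemma measurable_lim_or_default:
  fixes f :: "nat \<Rightarrow> 'w \<Rightarrow> 'a::polish_space"
  assumes [measurable]: "\<And>n. f n \<in> borel_measurable M"
  shows "(\<lambda>\<omega>. if convergent (\<lambda>n. f n \<omega>) then lim (\<lambda>n. f n \<omega>) else c) \<in> borel_measurable M"
proof (rule borel_measurable_LIMSEQ_metric)
  let ?f = "\<lambda>n \<omega>. if Cauchy (\<lambda>n. f n \<omega>) then f n \<omega> else c"
  show "?f n \<in> borel_measurable M" for n by measurable
  show "(\<lambda>n. ?f n \<omega>) \<longlonglongrightarrow> (if convergent (\<lambda>n. f n \<omega>) then lim (\<lambda>n. f n \<omega>) else c)" for \<omega>
    by (auto simp: Cauchy_convergent_iff convergent_LIMSEQ_iff)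
qed

section \<open>Conditional expectations of simple random elements\<close>

locale cc_probability = cc_space cc + prob_space M
  for cc :: "(real \<times> 'a::polish_space) list \<Rightarrow> 'a" and M :: "'w measure"
begin

lemma level_set:
  fixes Y :: "'w \<Rightarrow> 'b::t1_space"
  assumes "Y \<in> borel_measurable M"
  shows "{\<omega> \<in> space M. Y \<omega> = x} \<in> sets M"
  using measurable_sets[OF assms, of "{x}"] by (simp add: vimage_def Int_def conj_commute)

abbreviation cond_pr :: "'w measure \<Rightarrow> ('w \<Rightarrow> 'b) \<Rightarrow> 'b \<Rightarrow> 'w \<Rightarrow> real" where
  "cond_pr G Y x \<equiv> real_cond_exp M G (indicator {\<omega> \<in> space M. Y \<omega> = x})"

lemma cc_simple_cond_exp_eq:
  assumes "finite (Y ` space M)"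
  shows "cc_simple_cond_exp cc M G Y \<omega> =
    (if (\<forall>x\<in>Y ` space M. cond_pr G Y x \<omega> \<ge> 0) \<and> (\<Sum>x\<in>Y ` space M. cond_pr G Y x \<omega>) = 1
     then barycentre (Y ` space M) (\<lambda>x. cond_pr G Y x \<omega>)
     else cc_K cc (hd (SOME xs. distinct xs \<and> set xs = Y ` space M)))"
  using some_list[OF assms]
  by (simp add: cc_simple_cond_exp_def barycentre_def Let_def sum_list_distinct_conv_sum_set)

lemma measurable_cc_simple_cond_exp:
  assumes "finite (Y ` space M)"
  shows "cc_simple_cond_exp cc M G Y \<in> borel_measurable M"
proof -
  have "cc_space cc" by unfold_locales
  from measurable_barycentre[OF this assms, of "\<lambda>\<omega> x. cond_pr G Y x \<omega>" M]
  show ?thesis unfolding cc_simple_cond_exp_eq[OF assms, abs_def] by simp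
qed

text \<open>The sum is found by expanding the constant 1 over the level sets of \<open>Y\<close>.
  Almost surely this excludes the default branch of \<open>cc_simple_cond_exp\<close>.\<close>

lemma AE_cond_pr:
  fixes Y :: "'w \<Rightarrow> 'b::t1_space"
  assumes G: "subalgebra M G" and fin: "finite (Y ` space M)" and [measurable]: "Y \<in> borel_measurable M"
  shows "AE \<omega> in M. (\<forall>x\<in>Y ` space M. cond_pr G Y x \<omega> \<ge> 0) \<and> (\<Sum>x\<in>Y ` space M. cond_pr G Y x \<omega>) = 1"
proof -
  interpret G: finite_measure_subalgebra M G by (rule finite_measure_subalgebraI[OF G])
  note [measurable] = level_set[OF assms(3)]
  have "AE \<omega> in M. \<forall>x\<in>Y ` space M. cond_pr G Y x \<omega> \<ge> 0"
    by (intro AE_finite_allI fin G.real_cond_exp_pos) auto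
  moreover have "AE \<omega> in M. real_cond_exp M G (\<lambda>_. 1) \<omega> = (\<Sum>x\<in>Y ` space M. 1 * cond_pr G Y x \<omega>)"
    by (rule G.real_cond_exp_simple[OF fin]) (use fin in \<open>auto simp: indicator_def sum.delta\<close>)
  moreover have "AE \<omega> in M. real_cond_exp M G (\<lambda>_. 1) \<omega> = 1" by (rule G.real_cond_exp_F_meas) auto
  ultimately show ?thesis by eventually_elim auto
qed

lemma AE_cc_simple_cond_exp:
  assumes "subalgebra M G" "finite (Y ` space M)" "Y \<in> borel_measurable M"
  shows "AE \<omega> in M. cc_simple_cond_exp cc M G Y \<omega> = barycentre (Y ` space M) (\<lambda>x. cond_pr G Y x \<omega>)"
  using AE_cond_pr[OF assms] by eventually_elim (simp add: cc_simple_cond_exp_eq[OF assms(2)])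

text \<open>The conditional law of the pair \<open>(Y, Z)\<close> is a coupling of the two
  conditional laws, and its transport cost is the conditional expectation of the distance.\<close>

lemma dist_cc_simple_cond_exp_le:
  assumes G: "subalgebra M G"
    and Y: "finite (Y ` space M)" "Y \<in> borel_measurable M"
    and Z: "finite (Z ` space M)" "Z \<in> borel_measurable M"
  shows "AE \<omega> in M. dist (cc_simple_cond_exp cc M G Y \<omega>) (cc_simple_cond_exp cc M G Z \<omega>)
    \<le> real_cond_exp M G (\<lambda>\<omega>. dist (Y \<omega>) (Z \<omega>)) \<omega>"
proof -
  note [measurable] = Y(2) Z(2)
  interpret G: finite_measure_subalgebra M G by (rule finite_measure_subalgebraI[OF G])
  let ?A = "Y ` space M" and ?B = "Z ` space M"
  define J where "J x y = {\<omega> \<in> space M. Y \<omega> = x \<and> Z \<omega> = y}" for x y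
  have J [measurable]: "J x y \<in> sets M" for x y
    using sets.Int[OF level_set[OF Y(2), of x] level_set[OF Z(2), of y]]
    by (simp add: J_def Collect_conj_eq[symmetric] Int_def conj_ac cong: conj_cong)
  define r where "r x y = real_cond_exp M G (indicator (J x y))" for x y
  have "AE \<omega> in M. r x y \<omega> \<ge> 0" for x y
    unfolding r_def by (rule G.real_cond_exp_pos) auto
  then have 1: "AE \<omega> in M. \<forall>x\<in>?A. \<forall>y\<in>?B. r x y \<omega> \<ge> 0"
    by (intro AE_finite_allI Y Z)
  have "AE \<omega> in M. cond_pr G Y x \<omega> = (\<Sum>y\<in>?B. 1 * r x y \<omega>)" for x
    unfolding r_def
    by (rule G.real_cond_exp_simple[OF Z(1)])
      (use Z(1) in \<open>auto simp: indicator_def J_def if_distrib[of of_bool] sum.If_cases intro!: sum.neutral\<close>)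
  then have 2: "AE \<omega> in M. \<forall>x\<in>?A. (\<Sum>y\<in>?B. r x y \<omega>) = cond_pr G Y x \<omega>"
    by (intro AE_finite_allI Y) (simp add: eq_commute)
  have "AE \<omega> in M. cond_pr G Z y \<omega> = (\<Sum>x\<in>?A. 1 * r x y \<omega>)" for y
    unfolding r_def
    by (rule G.real_cond_exp_simple[OF Y(1)])
      (use Y(1) in \<open>auto simp: indicator_def J_def if_distrib[of of_bool] sum.If_cases intro!: sum.neutral\<close>)
  then have 3: "AE \<omega> in M. \<forall>y\<in>?B. (\<Sum>x\<in>?A. r x y \<omega>) = cond_pr G Z y \<omega>"
    by (intro AE_finite_allI Z) (simp add: eq_commute)
  have 4: "AE \<omega> in M. real_cond_exp M G (\<lambda>\<omega>. dist (Y \<omega>) (Z \<omega>)) \<omega>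
      = (\<Sum>i\<in>?A \<times> ?B. (case i of (x, y) \<Rightarrow> dist x y) * real_cond_exp M G (indicator (case i of (x, y) \<Rightarrow> J x y)) \<omega>)"
  proof (rule G.real_cond_exp_simple)
    fix \<omega> assume \<omega>: "\<omega> \<in> space M"
    have "(\<Sum>i\<in>?A \<times> ?B. (case i of (x, y) \<Rightarrow> dist x y) * indicator (case i of (x, y) \<Rightarrow> J x y) \<omega>)
        = (\<Sum>i\<in>?A \<times> ?B. if i = (Y \<omega>, Z \<omega>) then dist (Y \<omega>) (Z \<omega>) else 0)"
      by (intro sum.cong) (auto simp: J_def indicator_def \<omega>)
    also have "\<dots> = dist (Y \<omega>) (Z \<omega>)" using Y(1) Z(1) \<omega> by (subst sum.delta) auto
    finally show "dist (Y \<omega>) (Z \<omega>) = (\<Sum>i\<in>?A \<times> ?B. (case i of (x, y) \<Rightarrow> dist x y) * indicator (case i of (x, y) \<Rightarrow> J x y) \<omega>)"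
      by simp
  qed (use Y Z in auto)
  show ?thesis
    using 1 2 3 4 AE_cc_simple_cond_exp[OF G Y] AE_cc_simple_cond_exp[OF G Z] AE_cond_pr[OF G Y]
  proof eventually_elim
    case (elim \<omega>)
    have "dist (barycentre ?A (\<lambda>x. cond_pr G Y x \<omega>)) (barycentre ?B (\<lambda>y. cond_pr G Z y \<omega>))
        \<le> (\<Sum>x\<in>?A. \<Sum>y\<in>?B. r x y \<omega> * dist x y)"
      by (rule dist_barycentre_le) (use elim Y Z in auto)
    also have "\<dots> = real_cond_exp M G (\<lambda>\<omega>. dist (Y \<omega>) (Z \<omega>)) \<omega>"
      unfolding elim(4) r_def by (simp add: sum.cartesian_product split_beta mult.commute)
    finally show ?case using elim by simp
  qed
qed

lemma tendsto_cc_simple_cond_exp: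
  assumes F: "\<And>k. subalgebra M (F k)" and G: "subalgebra M G"
    and lim: "\<And>A. A \<in> sets M \<Longrightarrow>
      AE \<omega> in M. (\<lambda>k. real_cond_exp M (F k) (indicator A) \<omega>) \<longlonglongrightarrow> real_cond_exp M G (indicator A) \<omega>"
    and Y: "finite (Y ` space M)" "Y \<in> borel_measurable M"
  shows "AE \<omega> in M. (\<lambda>k. cc_simple_cond_exp cc M (F k) Y \<omega>) \<longlonglongrightarrow> cc_simple_cond_exp cc M G Y \<omega>"
proof -
  note [measurable] = Y(2)
  have "AE \<omega> in M. \<forall>x\<in>Y ` space M. (\<lambda>k. cond_pr (F k) Y x \<omega>) \<longlonglongrightarrow> cond_pr G Y x \<omega>"
    by (intro AE_finite_allI Y lim level_set)
  moreover have "AE \<omega> in M. \<forall>k. (\<forall>x\<in>Y ` space M. cond_pr (F k) Y x \<omega> \<ge> 0) \<and> (\<Sum>x\<in>Y ` space M. cond_pr (F k) Y x \<omega>) = 1"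
    unfolding AE_all_countable using AE_cond_pr[OF F Y] by blast
  moreover have "AE \<omega> in M. \<forall>k. cc_simple_cond_exp cc M (F k) Y \<omega> = barycentre (Y ` space M) (\<lambda>x. cond_pr (F k) Y x \<omega>)"
    unfolding AE_all_countable using AE_cc_simple_cond_exp[OF F Y] by blast
  ultimately show ?thesis
    using AE_cond_pr[OF G Y] AE_cc_simple_cond_exp[OF G Y]
  proof eventually_elim
    case (elim \<omega>)
    have "(\<lambda>k. barycentre (Y ` space M) (\<lambda>x. cond_pr (F k) Y x \<omega>))
        \<longlonglongrightarrow> barycentre (Y ` space M) (\<lambda>x. cond_pr G Y x \<omega>)"
      by (rule tendsto_barycentre[OF Y(1)]) (use elim in auto)
    then show ?case using elim by simp
  qed
qed

text \<open>Gives a bound that does not depend on \<open>G\<close>, used as a dominating constant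
  when \<open>G\<close> varies.\<close>

lemma dist_cc_simple_cond_exp_point_le:
  assumes G: "subalgebra M G" and Y: "finite (Y ` space M)" "Y \<in> borel_measurable M"
    and D: "\<And>\<omega>. \<omega> \<in> space M \<Longrightarrow> dist (Y \<omega>) z \<le> D"
  shows "AE \<omega> in M. dist (cc_simple_cond_exp cc M G Y \<omega>) (cc_K cc z) \<le> D"
  using AE_cond_pr[OF G Y] AE_cc_simple_cond_exp[OF G Y]
proof eventually_elim
  case (elim \<omega>)
  have "dist (barycentre (Y ` space M) (\<lambda>x. cond_pr G Y x \<omega>)) (cc_K cc z) \<le> (\<Sum>x\<in>Y ` space M. cond_pr G Y x \<omega> * dist x z)"
    by (rule dist_barycentre_point_le) (use elim Y in auto)
  also have "\<dots> \<le> (\<Sum>x\<in>Y ` space M. cond_pr G Y x \<omega> * D)"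
    using D elim by (intro sum_mono mult_left_mono) auto
  also have "\<dots> = D" using elim by (simp add: sum_distrib_right[symmetric])
  finally show ?case using elim by simp
qed

end

section \<open>Integrable random elements and their nearest-point approximations\<close>

locale cc_conditioning = cc_probability cc M
  for cc :: "(real \<times> 'a::polish_space) list \<Rightarrow> 'a" and M :: "'w measure" +
  fixes u :: "nat \<Rightarrow> 'a"
  assumes dense: "closure (u ` {1..}) = UNIV"
begin

lemma simple_nearest_point:
  assumes [measurable]: "X \<in> borel_measurable M"
  shows "finite ((nearest_point u n \<circ> X) ` space M)" "nearest_point u n \<circ> X \<in> borel_measurable M"
proof -
  have "(nearest_point u n \<circ> X) ` space M \<subseteq> u ` {0..n}"
    using nearest_index_props(1)[of u n] by (auto simp: nearest_point_def)
  then show "finite ((nearest_point u n \<circ> X) ` space M)" by (rule finite_subset) simp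
qed (simp add: comp_def)

abbreviation approx :: "'w measure \<Rightarrow> ('w \<Rightarrow> 'a) \<Rightarrow> nat \<Rightarrow> 'w \<Rightarrow> 'a" where
  "approx G X n \<equiv> cc_simple_cond_exp cc M G (nearest_point u n \<circ> X)"

abbreviation err :: "('w \<Rightarrow> 'a) \<Rightarrow> nat \<Rightarrow> 'w \<Rightarrow> real" where
  "err X n \<omega> \<equiv> dist (nearest_point u n (X \<omega>)) (X \<omega>)"

abbreviation cond_exp :: "'w measure \<Rightarrow> ('w \<Rightarrow> 'a) \<Rightarrow> 'w \<Rightarrow> 'a" where
  "cond_exp G X \<equiv> cc_cond_exp cc u M G X"

lemma measurable_cc_cond_exp:
  assumes "X \<in> borel_measurable M"
  shows "cond_exp G X \<in> borel_measurable M"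
  unfolding cc_cond_exp_def[abs_def] Let_def
  by (intro measurable_lim_or_default measurable_cc_simple_cond_exp simple_nearest_point assms)

context
  fixes X :: "'w \<Rightarrow> 'a"
  assumes X [measurable]: "X \<in> borel_measurable M"
    and int: "integrable M (\<lambda>\<omega>. dist (u 0) (X \<omega>))"
begin

text \<open>Index 0 is always a candidate, so one integrable function dominates the errors for all
  \<open>n\<close>.\<close>

lemma err_le: "err X n \<omega> \<le> dist (u 0) (X \<omega>)"
  by (rule nearest_index_props(2)) simp

lemma integrable_err: "integrable M (err X n)"
  by (rule Bochner_Integration.integrable_bound[OF int]) (use err_le in auto)

lemma integral_err_tendsto: "(\<lambda>n. \<integral>\<omega>. err X n \<omega> \<partial>M) \<longlonglongrightarrow> 0"
proof -
  have "(\<lambda>n. \<integral>\<omega>. err X n \<omega> \<partial>M) \<longlonglongrightarrow> (\<integral>\<omega>. 0 \<partial>M)"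
    by (rule integral_dominated_convergence[OF _ _ int])
      (use err_le nearest_point_tendsto[OF dense] in auto)
  then show ?thesis by simp
qed

lemma AE_cond_err_nonneg:
  assumes "subalgebra M G"
  shows "AE \<omega> in M. \<forall>n. real_cond_exp M G (err X n) \<omega> \<ge> 0"
proof -
  interpret G: finite_measure_subalgebra M G by (rule finite_measure_subalgebraI[OF assms])
  show ?thesis unfolding AE_all_countable by (intro allI G.real_cond_exp_pos) auto
qed

lemma markov_cond_exp:
  assumes "subalgebra M G" "integrable M h" "\<And>\<omega>. h \<omega> \<ge> 0" "c > 0"
  shows "c * prob {\<omega> \<in> space M. real_cond_exp M G h \<omega> > c} \<le> (\<integral>\<omega>. h \<omega> \<partial>M)"
  using doob_maximal_finite[of 0 "\<lambda>_. G" h c] assms by simp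

text \<open>The intersection of all \<open>B n\<close> is no more likely than any of them, and the
  bounds tend to 0. No monotonicity of the events is involved.\<close>

lemma AE_exists_small:
  assumes [measurable]: "\<And>n. B n \<in> sets M" and "C \<ge> 0"
    and le: "\<And>n. prob (B n) \<le> C * (\<integral>\<omega>. err X n \<omega> \<partial>M)"
  shows "AE \<omega> in M. \<exists>n. \<omega> \<notin> B n"
proof -
  have "prob (\<Inter>n. B n) \<le> 0"
  proof (rule LIMSEQ_le_const)
    show "(\<lambda>n. C * (\<integral>\<omega>. err X n \<omega> \<partial>M)) \<longlonglongrightarrow> 0"
      using tendsto_mult_left[OF integral_err_tendsto, of C] by simp
    have "prob (\<Inter>n. B n) \<le> C * (\<integral>\<omega>. err X n \<omega> \<partial>M)" for n
      using finite_measure_mono[of "\<Inter>n. B n" "B n"] le[of n] by (auto intro: order_trans)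
    then show "\<exists>N. \<forall>n\<ge>N. prob (\<Inter>n. B n) \<le> C * (\<integral>\<omega>. err X n \<omega> \<partial>M)" by blast
  qed
  then have "prob (\<Inter>n. B n) = 0" by (simp add: measure_le_0_iff)
  then have "AE \<omega> in M. \<omega> \<notin> (\<Inter>n. B n)" by (subst (asm) prob_eq_0) auto
  then show ?thesis by eventually_elim auto
qed

text \<open>Markov's inequality only yields one small term for each tolerance; the errors decrease
  in \<open>n\<close>, hence so do their conditional expectations, and all later terms are small
  too.\<close>

lemma AE_cond_err_tendsto:
  assumes G: "subalgebra M G"
  shows "AE \<omega> in M. (\<lambda>n. real_cond_exp M G (err X n) \<omega>) \<longlonglongrightarrow> 0"
proof -
  interpret G: finite_measure_subalgebra M G by (rule finite_measure_subalgebraI[OF G])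
  have "AE \<omega> in M. \<exists>n. real_cond_exp M G (err X n) \<omega> \<le> c" if "c > 0" for c
  proof -
    have "AE \<omega> in M. \<exists>n. \<omega> \<notin> {\<omega> \<in> space M. real_cond_exp M G (err X n) \<omega> > c}"
    proof (rule AE_exists_small)
      show "prob {\<omega> \<in> space M. real_cond_exp M G (err X n) \<omega> > c} \<le> 1 / c * (\<integral>\<omega>. err X n \<omega> \<partial>M)" for n
        using markov_cond_exp[OF G integrable_err _ that, of n] that by (simp add: field_simps)
    qed (use that in auto)
    with AE_space[of M] show ?thesis by eventually_elim (auto simp: not_less)
  qed
  then have small: "AE \<omega> in M. \<forall>i. \<exists>n. real_cond_exp M G (err X n) \<omega> \<le> inverse (real (Suc i))"
    unfolding AE_all_countable by auto
  have "AE \<omega> in M. \<forall>n. real_cond_exp M G (err X (Suc n)) \<omega> \<le> real_cond_exp M G (err X n) \<omega>"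
    unfolding AE_all_countable
    by (intro allI G.real_cond_exp_mono integrable_err AE_I2 nearest_point_dist_antimono) simp
  with small AE_cond_err_nonneg[OF G] show ?thesis
  proof eventually_elim
    case (elim \<omega>)
    have dec: "decseq (\<lambda>n. real_cond_exp M G (err X n) \<omega>)" using elim(3) by (simp add: decseq_Suc_iff)
    show ?case
    proof (rule LIMSEQ_I)
      fix r :: real assume "r > 0"
      then obtain i where "inverse (real (Suc i)) < r" using reals_Archimedean by blast
      moreover obtain n where "real_cond_exp M G (err X n) \<omega> \<le> inverse (real (Suc i))" using elim by blast
      ultimately have "norm (real_cond_exp M G (err X m) \<omega> - 0) < r" if "m \<ge> n" for m
        using decseqD[OF dec that] elim(2) by simp
      then show "\<exists>no. \<forall>m\<ge>no. norm (real_cond_exp M G (err X m) \<omega> - 0) < r" by blast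
    qed
  qed
qed

lemma AE_dist_approx_le:
  assumes G: "subalgebra M G"
  shows "AE \<omega> in M. \<forall>n m. dist (approx G X n \<omega>) (approx G X m \<omega>)
    \<le> real_cond_exp M G (err X n) \<omega> + real_cond_exp M G (err X m) \<omega>"
  unfolding AE_all_countable
proof (intro allI)
  fix n m
  interpret G: finite_measure_subalgebra M G by (rule finite_measure_subalgebraI[OF G])
  let ?f = "\<lambda>\<omega>. dist ((nearest_point u n \<circ> X) \<omega>) ((nearest_point u m \<circ> X) \<omega>)"
  have le: "?f \<omega> \<le> err X n \<omega> + err X m \<omega>" for \<omega> unfolding comp_def by (rule dist_triangle2)
  have sum: "integrable M (\<lambda>\<omega>. err X n \<omega> + err X m \<omega>)" using integrable_err by auto
  have "integrable M ?f"
    by (rule Bochner_Integration.integrable_bound[OF sum]) (use le in auto)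
  then have "AE \<omega> in M. real_cond_exp M G ?f \<omega> \<le> real_cond_exp M G (\<lambda>\<omega>. err X n \<omega> + err X m \<omega>) \<omega>"
    using le by (intro G.real_cond_exp_mono sum) auto
  moreover have "AE \<omega> in M. real_cond_exp M G (\<lambda>\<omega>. err X n \<omega> + err X m \<omega>) \<omega>
      = real_cond_exp M G (err X n) \<omega> + real_cond_exp M G (err X m) \<omega>"
    by (intro G.real_cond_exp_add integrable_err)
  moreover have "AE \<omega> in M. dist (approx G X n \<omega>) (approx G X m \<omega>) \<le> real_cond_exp M G ?f \<omega>"
    by (intro dist_cc_simple_cond_exp_le G simple_nearest_point X)
  ultimately show "AE \<omega> in M. dist (approx G X n \<omega>) (approx G X m \<omega>)
    \<le> real_cond_exp M G (err X n) \<omega> + real_cond_exp M G (err X m) \<omega>"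
    by eventually_elim auto
qed

text \<open>The pairwise estimate makes the approximations almost surely Cauchy, so the convergent
  branch of \<open>cc_cond_exp\<close> is the one that applies. Letting the second index tend to
  infinity removes its error.\<close>

lemma AE_dist_cond_exp_le:
  assumes G: "subalgebra M G"
  shows "AE \<omega> in M. \<forall>n. dist (approx G X n \<omega>) (cond_exp G X \<omega>) \<le> real_cond_exp M G (err X n) \<omega>"
  using AE_dist_approx_le[OF G] AE_cond_err_tendsto[OF G]
proof eventually_elim
  case (elim \<omega>)
  let ?e = "\<lambda>n. real_cond_exp M G (err X n) \<omega>" and ?S = "\<lambda>n. approx G X n \<omega>"
  have "Cauchy ?S"
  proof (rule metric_CauchyI)
    fix r :: real assume "r > 0"
    then obtain N where N: "\<And>n. n \<ge> N \<Longrightarrow> norm (?e n - 0) < r / 2"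
      using LIMSEQ_D[OF elim(2), of "r / 2"] by auto
    then have "dist (?S m) (?S n) < r" if "m \<ge> N" "n \<ge> N" for m n
      using elim(1)[rule_format, of m n] N[OF that(1)] N[OF that(2)] unfolding real_norm_def by linarith
    then show "\<exists>N. \<forall>m\<ge>N. \<forall>n\<ge>N. dist (?S m) (?S n) < r" by blast
  qed
  then have "convergent ?S" by (simp add: Cauchy_convergent_iff)
  then have lim: "?S \<longlonglongrightarrow> cond_exp G X \<omega>" by (simp add: cc_cond_exp_def Let_def convergent_LIMSEQ_iff)
  show ?case
  proof
    fix n
    have "(\<lambda>m. dist (?S n) (?S m)) \<longlonglongrightarrow> dist (?S n) (cond_exp G X \<omega>)"
      by (intro tendsto_intros lim)
    moreover have "(\<lambda>m. ?e n + ?e m) \<longlonglongrightarrow> ?e n + 0" by (intro tendsto_intros elim)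
    ultimately have "dist (?S n) (cond_exp G X \<omega>) \<le> ?e n + 0"
      by (rule LIMSEQ_le) (use elim(1) in blast)
    then show "dist (?S n) (cond_exp G X \<omega>) \<le> ?e n" by simp
  qed
qed

lemma AE_dist_approx_point_le:
  assumes G: "subalgebra M G"
  shows "AE \<omega> in M. dist (approx G X n \<omega>) (cc_K cc (u 0)) \<le> (\<Sum>j\<le>n. dist (u j) (u 0))"
proof (rule dist_cc_simple_cond_exp_point_le[OF G simple_nearest_point[OF X]])
  fix \<omega>
  show "dist ((nearest_point u n \<circ> X) \<omega>) (u 0) \<le> (\<Sum>j\<le>n. dist (u j) (u 0))"
    using nearest_index_props(1)[of u n "X \<omega>"]
    by (auto simp: nearest_point_def intro!: member_le_sum[of "nearest_index u n (X \<omega>)" "{..n}" "\<lambda>j. dist (u j) (u 0)"])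
qed

section \<open>Almost sure convergence along a family of sub-sigma-algebras\<close>

context
  fixes F :: "nat \<Rightarrow> 'w measure" and G :: "'w measure"
  assumes F: "\<And>k. subalgebra M (F k)" and G: "subalgebra M G"
    and levy: "\<And>A. A \<in> sets M \<Longrightarrow>
      AE \<omega> in M. (\<lambda>k. real_cond_exp M (F k) (indicator A) \<omega>) \<longlonglongrightarrow> real_cond_exp M G (indicator A) \<omega>"
begin

lemma AE_approx_tendsto: "AE \<omega> in M. (\<lambda>k. approx (F k) X n \<omega>) \<longlonglongrightarrow> approx G X n \<omega>"
  by (intro tendsto_cc_simple_cond_exp F G levy simple_nearest_point X)

text \<open>By the maximal inequality the error of the \<open>n\<close>-th approximation is small for all \<open>k\<close>
  simultaneously, outside an event of small probability.\<close>

lemma AE_cond_exp_tendsto: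
  assumes maximal: "\<And>h c. integrable M h \<Longrightarrow> (\<And>\<omega>. h \<omega> \<ge> 0) \<Longrightarrow> c > 0 \<Longrightarrow>
      c * prob {\<omega> \<in> space M. \<exists>k. real_cond_exp M (F k) h \<omega> > c} \<le> (\<integral>\<omega>. h \<omega> \<partial>M)"
  shows "AE \<omega> in M. (\<lambda>k. cond_exp (F k) X \<omega>) \<longlonglongrightarrow> cond_exp G X \<omega>"
proof -
  have close: "AE \<omega> in M. \<exists>n. (\<forall>k. real_cond_exp M (F k) (err X n) \<omega> \<le> c) \<and> real_cond_exp M G (err X n) \<omega> \<le> c"
    if "c > 0" for c
  proof -
    let ?A = "\<lambda>n. {\<omega> \<in> space M. \<exists>k. real_cond_exp M (F k) (err X n) \<omega> > c}"
    let ?B = "\<lambda>n. {\<omega> \<in> space M. real_cond_exp M G (err X n) \<omega> > c}"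
    \<comment> \<open>One \<open>n\<close> must serve every \<open>F k\<close> and also
      \<open>G\<close>, so their bad events are united; it may depend on \<omega>.\<close>
    have "AE \<omega> in M. \<exists>n. \<omega> \<notin> ?A n \<union> ?B n"
    proof (rule AE_exists_small)
      fix n
      show "?A n \<union> ?B n \<in> sets M" by measurable
      have "prob (?A n) \<le> 1 / c * (\<integral>\<omega>. err X n \<omega> \<partial>M)"
        using maximal[OF integrable_err _ that, of n] that by (simp add: field_simps)
      moreover have "prob (?B n) \<le> 1 / c * (\<integral>\<omega>. err X n \<omega> \<partial>M)"
        using markov_cond_exp[OF G integrable_err _ that, of n] that by (simp add: field_simps)
      moreover have "prob (?A n \<union> ?B n) \<le> prob (?A n) + prob (?B n)"
        by (rule measure_Un_le) measurable
      ultimately show "prob (?A n \<union> ?B n) \<le> 2 / c * (\<integral>\<omega>. err X n \<omega> \<partial>M)" by simp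
    qed (use that in simp)
    with AE_space[of M] show ?thesis by eventually_elim (auto simp: not_less)
  qed
  have "AE \<omega> in M. \<forall>i. \<exists>n. (\<forall>k. real_cond_exp M (F k) (err X n) \<omega> \<le> inverse (real (Suc i))) \<and>
      real_cond_exp M G (err X n) \<omega> \<le> inverse (real (Suc i))"
    unfolding AE_all_countable by (intro allI close) simp
  moreover have "AE \<omega> in M. \<forall>k n. dist (approx (F k) X n \<omega>) (cond_exp (F k) X \<omega>) \<le> real_cond_exp M (F k) (err X n) \<omega>"
    by (subst AE_all_countable) (intro allI AE_dist_cond_exp_le F)
  moreover note AE_dist_cond_exp_le[OF G]
  moreover have "AE \<omega> in M. \<forall>n. (\<lambda>k. approx (F k) X n \<omega>) \<longlonglongrightarrow> approx G X n \<omega>"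
    by (subst AE_all_countable) (intro allI AE_approx_tendsto)
  ultimately show ?thesis
  proof eventually_elim
    case (elim \<omega>)
    show ?case
    proof (rule metric_LIMSEQ_I)
      fix r :: real assume "r > 0"
      then obtain i where i: "inverse (real (Suc i)) < r / 3" using reals_Archimedean[of "r / 3"] by auto
      obtain n where n: "\<And>k. real_cond_exp M (F k) (err X n) \<omega> \<le> inverse (real (Suc i))"
        "real_cond_exp M G (err X n) \<omega> \<le> inverse (real (Suc i))" using elim(1) by blast
      obtain N where N: "\<And>k. k \<ge> N \<Longrightarrow> dist (approx (F k) X n \<omega>) (approx G X n \<omega>) < r / 3"
        using metric_LIMSEQ_D[OF elim(4)[rule_format, of n], of "r / 3"] \<open>r > 0\<close> by auto
      have "dist (cond_exp (F k) X \<omega>) (cond_exp G X \<omega>) < r" if "k \<ge> N" for k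
      proof -
        have "dist (cond_exp (F k) X \<omega>) (cond_exp G X \<omega>)
            \<le> dist (approx (F k) X n \<omega>) (cond_exp (F k) X \<omega>) + dist (approx (F k) X n \<omega>) (cond_exp G X \<omega>)"
          by (rule dist_triangle3)
        also have "dist (approx (F k) X n \<omega>) (cond_exp G X \<omega>)
            \<le> dist (approx (F k) X n \<omega>) (approx G X n \<omega>) + dist (approx G X n \<omega>) (cond_exp G X \<omega>)"
          by (rule dist_triangle)
        finally show ?thesis
          using elim(2)[rule_format, of k n] elim(3)[rule_format, of n] n(1)[of k] n(2) N[OF that] i by linarith
      qed
      then show "\<exists>N. \<forall>k\<ge>N. dist (cond_exp (F k) X \<omega>) (cond_exp G X \<omega>) < r" by blast
    qed
  qed
qed

end

section \<open>Convergence in L^p\<close>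

context
  fixes p :: real
  assumes p: "p \<ge> 1" and intp: "integrable M (\<lambda>\<omega>. dist (u 0) (X \<omega>) powr p)"
begin

lemma integrable_err_powr: "integrable M (\<lambda>\<omega>. err X n \<omega> powr p)"
  by (rule Bochner_Integration.integrable_bound[OF intp]) (use err_le p in \<open>auto intro!: powr_mono2\<close>)

lemma integral_err_powr_tendsto: "(\<lambda>n. \<integral>\<omega>. err X n \<omega> powr p \<partial>M) \<longlonglongrightarrow> 0"
proof -
  have "(\<lambda>n. \<integral>\<omega>. err X n \<omega> powr p \<partial>M) \<longlonglongrightarrow> (\<integral>\<omega>. 0 \<partial>M)"
  proof (rule integral_dominated_convergence[OF _ _ intp])
    show "AE \<omega> in M. (\<lambda>n. err X n \<omega> powr p) \<longlonglongrightarrow> 0"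
      using p by (intro AE_I2 tendsto_zero_powrI[OF nearest_point_tendsto[OF dense] tendsto_const]) auto
    show "AE \<omega> in M. norm (err X n \<omega> powr p) \<le> dist (u 0) (X \<omega>) powr p" for n
      using err_le p by (auto intro!: powr_mono2)
  qed auto
  then show ?thesis by simp
qed

lemma cond_err_powr:
  assumes "subalgebra M G"
  shows "integrable M (\<lambda>\<omega>. real_cond_exp M G (err X n) \<omega> powr p)"
    and "(\<integral>\<omega>. real_cond_exp M G (err X n) \<omega> powr p \<partial>M) \<le> (\<integral>\<omega>. err X n \<omega> powr p \<partial>M)"
proof -
  interpret G: finite_measure_subalgebra M G by (rule finite_measure_subalgebraI[OF assms])
  show "integrable M (\<lambda>\<omega>. real_cond_exp M G (err X n) \<omega> powr p)"
    "(\<integral>\<omega>. real_cond_exp M G (err X n) \<omega> powr p \<partial>M) \<le> (\<integral>\<omega>. err X n \<omega> powr p \<partial>M)"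
    by (intro G.real_cond_exp_powr_le p integrable_err integrable_err_powr zero_le_dist)+
qed

text \<open>The approximation with \<open>n = 0\<close> is almost surely the constant
  \<open>cc_K cc (u 0)\<close>, so the distance to that point is at most the conditional error at 0,
  whose p-th power is integrable by Jensen's inequality.\<close>

lemma cond_exp_Lp:
  assumes G: "subalgebra M G"
  shows "cond_exp G X \<in> Lp_elements M p"
proof -
  let ?z = "cc_K cc (u 0)"
  note [measurable] = measurable_cc_cond_exp[OF X, of G]
  have "AE \<omega> in M. dist ?z (cond_exp G X \<omega>) powr p \<le> real_cond_exp M G (err X 0) \<omega> powr p"
    using AE_dist_approx_point_le[OF G, of 0] AE_dist_cond_exp_le[OF G]
  proof eventually_elim
    case (elim \<omega>)
    \<comment> \<open>For \<open>n = 0\<close> the bounding sum is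
      \<open>dist (u 0) (u 0) = 0\<close>.\<close>
    have "approx G X 0 \<omega> = ?z" using elim(1) by simp
    then have "dist ?z (cond_exp G X \<omega>) \<le> real_cond_exp M G (err X 0) \<omega>" using elim(2) by metis
    then show ?case using p by (intro powr_mono2) auto
  qed
  then have "integrable M (\<lambda>\<omega>. dist ?z (cond_exp G X \<omega>) powr p)"
    by (intro Bochner_Integration.integrable_bound[OF cond_err_powr(1)[OF G, of 0]]) auto
  then show ?thesis unfolding Lp_elements_def by auto
qed

text \<open>The distance passes through the two approximations of level \<open>n\<close>. The outer
  terms are bounded in L^p uniformly in \<open>k\<close>, so \<open>n\<close> is fixed first. For
  that \<open>n\<close> the middle term \<open>mid\<close> is bounded by a constant and tends to 0
  by dominated convergence.\<close>

lemma Lp_cond_exp_tendsto: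
  assumes F: "\<And>k. subalgebra M (F k)" and G: "subalgebra M G"
    and levy: "\<And>A. A \<in> sets M \<Longrightarrow>
      AE \<omega> in M. (\<lambda>k. real_cond_exp M (F k) (indicator A) \<omega>) \<longlonglongrightarrow> real_cond_exp M G (indicator A) \<omega>"
  shows "Lp_converges M p (\<lambda>k. cond_exp (F k) X) (cond_exp G X)"
proof -
  note [measurable] = measurable_cc_cond_exp[OF X]
    measurable_cc_simple_cond_exp[OF simple_nearest_point(1)[OF X]]
  define I where "I k = (\<integral>\<omega>. dist (cond_exp (F k) X \<omega>) (cond_exp G X \<omega>) powr p \<partial>M)" for k
  define mid where "mid n k \<omega> = dist (approx (F k) X n \<omega>) (approx G X n \<omega>) powr p" for n k \<omega>
  have [measurable]: "mid n k \<in> borel_measurable M" for n k unfolding mid_def[abs_def] by measurable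
  have mid_bound: "AE \<omega> in M. norm (mid n k \<omega>) \<le> (2 * (\<Sum>j\<le>n. dist (u j) (u 0))) powr p" for n k
    using AE_dist_approx_point_le[OF F[of k], of n] AE_dist_approx_point_le[OF G, of n]
  proof eventually_elim
    case (elim \<omega>)
    have "dist (approx (F k) X n \<omega>) (approx G X n \<omega>) \<le> 2 * (\<Sum>j\<le>n. dist (u j) (u 0))"
      using dist_triangle2[of "approx (F k) X n \<omega>" "approx G X n \<omega>" "cc_K cc (u 0)"] elim by simp
    then show ?case using p by (auto simp: mid_def intro!: powr_mono2)
  qed
  have mid_int: "integrable M (mid n k)" for n k
    by (rule integrable_const_bound[OF mid_bound]) measurable
  have mid_lim: "(\<lambda>k. \<integral>\<omega>. mid n k \<omega> \<partial>M) \<longlonglongrightarrow> 0" for n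
  proof -
    have "(\<lambda>k. \<integral>\<omega>. mid n k \<omega> \<partial>M) \<longlonglongrightarrow> (\<integral>\<omega>. 0 \<partial>M)"
    proof (rule integral_dominated_convergence[OF _ _ _ _ mid_bound])
      have "AE \<omega> in M. (\<lambda>k. approx (F k) X n \<omega>) \<longlonglongrightarrow> approx G X n \<omega>"
        by (rule AE_approx_tendsto[OF F G levy])
      then show "AE \<omega> in M. (\<lambda>k. mid n k \<omega>) \<longlonglongrightarrow> 0"
      proof eventually_elim
        case (elim \<omega>)
        have "(\<lambda>k. dist (approx (F k) X n \<omega>) (approx G X n \<omega>)) \<longlonglongrightarrow> 0"
          using elim by (simp add: tendsto_dist_iff[symmetric])
        then show ?case unfolding mid_def using p by (intro tendsto_zero_powrI[OF _ tendsto_const]) auto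
      qed
    qed auto
    then show ?thesis by simp
  qed
  have I_le: "I k \<le> 3 powr p * (2 * (\<integral>\<omega>. err X n \<omega> powr p \<partial>M) + (\<integral>\<omega>. mid n k \<omega> \<partial>M))" for n k
  proof -
    let ?a = "\<lambda>\<omega>. real_cond_exp M (F k) (err X n) \<omega>" and ?b = "\<lambda>\<omega>. real_cond_exp M G (err X n) \<omega>"
    let ?bound = "\<lambda>\<omega>. 3 powr p * (?a \<omega> powr p + mid n k \<omega> + ?b \<omega> powr p)"
    have le: "AE \<omega> in M. dist (cond_exp (F k) X \<omega>) (cond_exp G X \<omega>) powr p \<le> ?bound \<omega>"
      using AE_dist_cond_exp_le[OF F[of k]] AE_dist_cond_exp_le[OF G]
        AE_cond_err_nonneg[OF F[of k]] AE_cond_err_nonneg[OF G]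
    proof eventually_elim
      case (elim \<omega>)
      let ?m = "dist (approx (F k) X n \<omega>) (approx G X n \<omega>)"
      have "dist (cond_exp (F k) X \<omega>) (cond_exp G X \<omega>)
          \<le> dist (approx (F k) X n \<omega>) (cond_exp (F k) X \<omega>) + dist (approx (F k) X n \<omega>) (cond_exp G X \<omega>)"
        by (rule dist_triangle3)
      also have "dist (approx (F k) X n \<omega>) (cond_exp G X \<omega>) \<le> ?m + dist (approx G X n \<omega>) (cond_exp G X \<omega>)"
        by (rule dist_triangle)
      finally have "dist (cond_exp (F k) X \<omega>) (cond_exp G X \<omega>) \<le> ?a \<omega> + ?m + ?b \<omega>"
        using elim(1)[rule_format, of n] elim(2)[rule_format, of n] by linarith
      then have "dist (cond_exp (F k) X \<omega>) (cond_exp G X \<omega>) powr p \<le> (?a \<omega> + ?m + ?b \<omega>) powr p"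
        using p by (intro powr_mono2) auto
      also have "\<dots> \<le> ?bound \<omega>"
        unfolding mid_def using elim p by (intro powr_add3_le) auto
      finally show ?case .
    qed
    have bound: "integrable M ?bound"
      using cond_err_powr(1)[OF F] cond_err_powr(1)[OF G] mid_int by simp
    have "I k \<le> (\<integral>\<omega>. ?bound \<omega> \<partial>M)"
      unfolding I_def by (rule integral_mono_AE[OF integrable_nonneg_bound[OF bound _ _ le] bound le]) auto
    also have "\<dots> = 3 powr p * ((\<integral>\<omega>. ?a \<omega> powr p \<partial>M) + (\<integral>\<omega>. mid n k \<omega> \<partial>M) + (\<integral>\<omega>. ?b \<omega> powr p \<partial>M))"
      using cond_err_powr(1)[OF F] cond_err_powr(1)[OF G] mid_int by simp
    also have "\<dots> \<le> 3 powr p * (2 * (\<integral>\<omega>. err X n \<omega> powr p \<partial>M) + (\<integral>\<omega>. mid n k \<omega> \<partial>M))"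
      using cond_err_powr(2)[OF F, of k n] cond_err_powr(2)[OF G, of n] by (intro mult_left_mono) auto
    finally show ?thesis .
  qed
  have "I \<longlonglongrightarrow> 0"
  proof (rule LIMSEQ_I)
    fix r :: real assume "r > 0"
    \<comment> \<open>Two error terms and one middle term use three of the four shares; the fourth
      keeps the inequality strict.\<close>
    let ?r = "r / (3 powr p * 4)"
    have "?r > 0" using \<open>r > 0\<close> by simp
    obtain n where "norm ((\<integral>\<omega>. err X n \<omega> powr p \<partial>M) - 0) < ?r"
      using LIMSEQ_D[OF integral_err_powr_tendsto \<open>?r > 0\<close>] by blast
    then have n: "(\<integral>\<omega>. err X n \<omega> powr p \<partial>M) < ?r" by simp
    obtain N where N: "\<And>k. k \<ge> N \<Longrightarrow> norm ((\<integral>\<omega>. mid n k \<omega> \<partial>M) - 0) < ?r"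
      using LIMSEQ_D[OF mid_lim \<open>?r > 0\<close>] by blast
    have "norm (I k - 0) < r" if "k \<ge> N" for k
    proof -
      have "I k \<le> 3 powr p * (2 * (\<integral>\<omega>. err X n \<omega> powr p \<partial>M) + (\<integral>\<omega>. mid n k \<omega> \<partial>M))" by (rule I_le)
      also have "\<dots> < 3 powr p * (4 * ?r)"
      proof (rule mult_strict_left_mono)
        have "(\<integral>\<omega>. mid n k \<omega> \<partial>M) < ?r" using N[OF that] by simp
        then show "2 * (\<integral>\<omega>. err X n \<omega> powr p \<partial>M) + (\<integral>\<omega>. mid n k \<omega> \<partial>M) < 4 * ?r"
          using n \<open>?r > 0\<close> by linarith
      qed simp
      also have "\<dots> = r" by simp
      finally have "I k < r" .
      moreover have "I k \<ge> 0" unfolding I_def by (rule Bochner_Integration.integral_nonneg) simp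
      ultimately show ?thesis by simp
    qed
    then show "\<exists>N. \<forall>k\<ge>N. norm (I k - 0) < r" by blast
  qed
  then have "(\<lambda>k. I k powr (1 / p)) \<longlonglongrightarrow> 0"
  proof (rule tendsto_zero_powrI[OF _ tendsto_const])
    show "\<forall>\<^sub>F k in sequentially. 0 \<le> I k"
      unfolding I_def by (intro always_eventually allI Bochner_Integration.integral_nonneg) simp
  qed (use p in simp)
  then show ?thesis
    unfolding Lp_converges_def Lp_dist_def I_def using cond_exp_Lp F G by blast
qed

end
end

text \<open>Frees the base point, which the definition only asserts to exist, so that
  \<open>u 0\<close> can be used. Integrability of the distance itself follows from comparing it
  with 1 plus its p-th power.\<close>

lemma Lp_elements_integrable:
  fixes X :: "'w \<Rightarrow> 'a"
  assumes "X \<in> Lp_elements M p" "p \<ge> 1"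
  shows "X \<in> borel_measurable M" "integrable M (\<lambda>\<omega>. dist z (X \<omega>) powr p)" "integrable M (\<lambda>\<omega>. dist z (X \<omega>))"
proof -
  obtain v where v: "integrable M (\<lambda>\<omega>. dist v (X \<omega>) powr p)" and X [measurable]: "X \<in> borel_measurable M"
    using assms by (auto simp: Lp_elements_def)
  show "X \<in> borel_measurable M" by fact
  have le: "dist z (X \<omega>) powr p \<le> 3 powr p * (dist z v powr p + dist v (X \<omega>) powr p)" for \<omega>
  proof -
    have "dist z (X \<omega>) powr p \<le> (dist z v + dist v (X \<omega>) + 0) powr p"
      using dist_triangle[of z "X \<omega>" v] assms(2) by (intro powr_mono2) auto
    also have "\<dots> \<le> 3 powr p * (dist z v powr p + dist v (X \<omega>) powr p + 0 powr p)"
      using assms(2) by (intro powr_add3_le) auto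
    finally show ?thesis by simp
  qed
  have "integrable M (\<lambda>\<omega>. 3 powr p * (dist z v powr p + dist v (X \<omega>) powr p))" using v by simp
  then show *: "integrable M (\<lambda>\<omega>. dist z (X \<omega>) powr p)"
    by (rule integrable_nonneg_bound) (use le in auto)
  have le1: "dist z (X \<omega>) \<le> 1 + dist z (X \<omega>) powr p" for \<omega>
  proof (cases "dist z (X \<omega>) \<le> 1")
    case False
    then show ?thesis using powr_mono[of 1 p "dist z (X \<omega>)"] assms(2) by simp
  qed (simp add: add_increasing2)
  have "integrable M (\<lambda>\<omega>. 1 + dist z (X \<omega>) powr p)" using * by simp
  then show "integrable M (\<lambda>\<omega>. dist z (X \<omega>))"
    by (rule integrable_nonneg_bound) (use le1 in auto)
qed

lemma monotone_convergence:
  assumes F: "monotone_subalgebras M F" and G: "subalgebra M G"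
    and levy: "\<And>A. A \<in> sets M \<Longrightarrow>
      AE \<omega> in M. (\<lambda>k. real_cond_exp M (F k) (indicator A) \<omega>) \<longlonglongrightarrow> real_cond_exp M G (indicator A) \<omega>"
    and X: "X \<in> Lp_elements M p" and p: "p \<ge> 1"
  shows "(AE \<omega> in M. (\<lambda>k. cond_exp (F k) X \<omega>) \<longlonglongrightarrow> cond_exp G X \<omega>) \<and>
    Lp_converges M p (\<lambda>k. cond_exp (F k) X) (cond_exp G X)"
proof -
  interpret F: monotone_subalgebras M F by fact
  note X' = Lp_elements_integrable[OF X p]
  show ?thesis
  proof
    show "AE \<omega> in M. (\<lambda>k. cond_exp (F k) X \<omega>) \<longlonglongrightarrow> cond_exp G X \<omega>"
      by (rule AE_cond_exp_tendsto[OF X'(1,3) F.sub G levy F.doob_maximal])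
    show "Lp_converges M p (\<lambda>k. cond_exp (F k) X) (cond_exp G X)"
      by (rule Lp_cond_exp_tendsto[OF X'(1,3) p X'(2) F.sub G levy])
  qed
qed

end

theorem proposition4p13:
  fixes cc :: "(real \<times> 'a::polish_space) list \<Rightarrow> 'a"
    and u :: "nat \<Rightarrow> 'a"
    and M :: "'w measure"
  assumes "cc_space cc"
    and "prob_space M" and "complete_measure M" and "atomless M"
    and "u 0 \<in> range (cc_K cc)" and "closure (u ` {1..}) = UNIV"
  shows
    "(\<forall>(F :: nat \<Rightarrow> 'w measure) (p :: real) (X :: 'w \<Rightarrow> 'a).
        (\<forall>n. subalgebra M (F n)) \<longrightarrow> incseq (\<lambda>n. sets (F n)) \<longrightarrow> p \<ge> 1 \<longrightarrow> X \<in> Lp_elements M p \<longrightarrow>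
        (let F_inf = sigma (space M) (\<Union>n. sets (F n)) in
          (AE \<omega> in M. (\<lambda>n. cc_cond_exp cc u M (F n) X \<omega>) \<longlonglongrightarrow> cc_cond_exp cc u M F_inf X \<omega>) \<and>
          Lp_converges M p (\<lambda>n. cc_cond_exp cc u M (F n) X) (cc_cond_exp cc u M F_inf X)))
     \<and>
     (\<forall>(F :: nat \<Rightarrow> 'w measure) (p :: real) (X :: 'w \<Rightarrow> 'a).
        (\<forall>n. subalgebra M (F n)) \<longrightarrow> decseq (\<lambda>n. sets (F n)) \<longrightarrow> p \<ge> 1 \<longrightarrow> X \<in> Lp_elements M p \<longrightarrow>
        (let F_inf = sigma (space M) (\<Inter>n. sets (F n)) in
          (AE \<omega> in M. (\<lambda>n. cc_cond_exp cc u M (F n) X \<omega>) \<longlonglongrightarrow> cc_cond_exp cc u M F_inf X \<omega>) \<and>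
          Lp_converges M p (\<lambda>n. cc_cond_exp cc u M (F n) X) (cc_cond_exp cc u M F_inf X)))"
proof -
  interpret cc_space cc by fact
  interpret prob_space M by fact
  interpret cc_conditioning cc M u by unfold_locales fact
  have mono: "monotone_subalgebras M F"
    if "\<forall>n. subalgebra M (F n)" "incseq (\<lambda>n. sets (F n)) \<or> decseq (\<lambda>n. sets (F n))" for F
    using that by unfold_locales auto
  show ?thesis
    unfolding Let_def
  proof (intro conjI allI impI)
    fix F :: "nat \<Rightarrow> 'w measure" and p :: real and X :: "'w \<Rightarrow> 'a"
    assume F: "\<forall>n. subalgebra M (F n)" and inc: "incseq (\<lambda>n. sets (F n))" and "p \<ge> 1" "X \<in> Lp_elements M p"
    interpret F: monotone_subalgebras M F by (rule mono) (use F inc in auto)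
    have "(AE \<omega> in M. (\<lambda>n. cc_cond_exp cc u M (F n) X \<omega>) \<longlonglongrightarrow> cc_cond_exp cc u M (sigma (space M) (\<Union>n. sets (F n))) X \<omega>) \<and>
      Lp_converges M p (\<lambda>n. cc_cond_exp cc u M (F n) X) (cc_cond_exp cc u M (sigma (space M) (\<Union>n. sets (F n))) X)"
    \<comment> \<open>Levy's theorem is required for indicators only, because conditional
      expectations of simple elements see nothing but their level sets; the bound is then 1.\<close>
    proof (rule monotone_convergence[OF F.monotone_subalgebras_axioms F.subalgebra_Union])
      fix A assume "A \<in> sets M"
      then show "AE \<omega> in M. (\<lambda>k. real_cond_exp M (F k) (indicator A) \<omega>)
          \<longlonglongrightarrow> real_cond_exp M (sigma (space M) (\<Union>n. sets (F n))) (indicator A) \<omega>"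
        by (intro F.levy_upward[of "indicator A" 1] inc) auto
    qed fact+
    then show "AE \<omega> in M. (\<lambda>n. cc_cond_exp cc u M (F n) X \<omega>) \<longlonglongrightarrow> cc_cond_exp cc u M (sigma (space M) (\<Union>n. sets (F n))) X \<omega>"
      "Lp_converges M p (\<lambda>n. cc_cond_exp cc u M (F n) X) (cc_cond_exp cc u M (sigma (space M) (\<Union>n. sets (F n))) X)"
      by blast+
  next
    fix F :: "nat \<Rightarrow> 'w measure" and p :: real and X :: "'w \<Rightarrow> 'a"
    assume F: "\<forall>n. subalgebra M (F n)" and dec: "decseq (\<lambda>n. sets (F n))" and "p \<ge> 1" "X \<in> Lp_elements M p"
    interpret F: monotone_subalgebras M F by (rule mono) (use F dec in auto)
    have "(AE \<omega> in M. (\<lambda>n. cc_cond_exp cc u M (F n) X \<omega>) \<longlonglongrightarrow> cc_cond_exp cc u M (sigma (space M) (\<Inter>n. sets (F n))) X \<omega>) \<and>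
      Lp_converges M p (\<lambda>n. cc_cond_exp cc u M (F n) X) (cc_cond_exp cc u M (sigma (space M) (\<Inter>n. sets (F n))) X)"
    proof (rule monotone_convergence[OF F.monotone_subalgebras_axioms F.subalgebra_Inter])
      fix A assume "A \<in> sets M"
      then show "AE \<omega> in M. (\<lambda>k. real_cond_exp M (F k) (indicator A) \<omega>)
          \<longlonglongrightarrow> real_cond_exp M (sigma (space M) (\<Inter>n. sets (F n))) (indicator A) \<omega>"
        by (intro F.levy_downward[of "indicator A" 1] dec) auto
    qed fact+
    then show "AE \<omega> in M. (\<lambda>n. cc_cond_exp cc u M (F n) X \<omega>) \<longlonglongrightarrow> cc_cond_exp cc u M (sigma (space M) (\<Inter>n. sets (F n))) X \<omega>"
      "Lp_converges M p (\<lambda>n. cc_cond_exp cc u M (F n) X) (cc_cond_exp cc u M (sigma (space M) (\<Inter>n. sets (F n))) X)"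
      by blast+
  qed
qed

end
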